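(* For every $H\in\mathbb{R}$, the family $\{\tilde\Sigma^+_{H,c}\}_{0<c\le C_H}$ of $T$-axisymmetric spacelike spherically symmetric constant mean curvature hypersurfaces forms a foliation of the part of region II$'$ of the Kruskal extension lying between $r=0$ and the cylindrical hypersurface $r=R_H$. That is, the hypersurfaces $\tilde\Sigma^+_{H,c}$, $c\in(0,C_H]$, are pairwise disjoint, and their union is $\{(U,V): U>0,\ V<0,\ 0<r(U,V)\le R_H\}$.
   Context: Fix $M>0$ and put $h(r)=1-\frac{2M}{r}$. The Kruskal extension of the Schwarzschild spacetime is $\{(U,V)\in\mathbb{R}^2: UV>-2M\}\times S^2$ with metric $\frac{16M^2e^{-r/(2M)}}{r}\,dU\,dV+r^2(d\theta^2+\sin^2\theta\,d\phi^2)$, where $r=r(U,V)>0$ is determined by $(r-2M)e^{r/(2M)}=UV$. Region II$'$ is $\{U>0,V<0\}$; there the Schwarzschild time is $t=2M\ln|V/U|$. Spherically symmetric hypersurfaces are identified with curves in the $(U,V)$-plane; such a curve is $T$-axisymmetric if it is invariant under $\rho(U,V)=(-V,-U)$. For $H\in\mathbb{R}$ let $\tilde k_H(r)=-Hr^3+r^{3/2}(2M-r)^{1/2}$ on $(0,2M)$. It has a unique maximum point $R_H\in(0,2M)$, with maximum value $C_H=\tilde k_H(R_H)>0$; it is strictly increasing on $(0,R_H]$ (with limit $0$ at $r=0$) and strictly decreasing on $[R_H,2M)$. For $c\in(0,C_H)$ let $\tilde r^+_{H,c}\in(0,R_H)$ be the solution of $\tilde k_H(r)=c$ in $(0,R_H)$,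 and for $r\in(0,\tilde r^+_{H,c}]$ let $$f(r;H,c)=\int_{\tilde r^+_{H,c}}^{r}\frac{x}{2M-x}\,\frac{Hx^3+c}{\sqrt{(Hx^3+c)^2+x^3(x-2M)}}\,dx\ (\le 0).$$ The hypersurface $\tilde\Sigma^+_{H,c}$ (spacelike, of constant mean curvature $H$, $T$-axisymmetric and contained in region II$'$) is the union of the curve $$U(r;c)=e^{-\frac1{4M}(f(r;H,c)-r-2M\ln|r-2M|)},\quad V(r;c)=-e^{\frac1{4M}(f(r;H,c)+r+2M\ln|r-2M|)},\quad 0<r\le \tilde r^+_{H,c},$$ (the part in $U+V\ge 0$) and its image under $\rho$. For $c=C_H$, $\tilde\Sigma^+_{H,C_H}$ is the cylindrical hypersurface $r=R_H$ in region II$'$. *)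

theory Defs
  imports "HOL-Analysis.Analysis"
begin

text \<open>
  Throughout, \<open>M\<close> is the mass parameter, and a spherically symmetric subset of the Kruskal extension
  is represented by its projection to the \<open>(U, V)\<close>-plane: a set \<open>S\<close> stands for \<open>S \<times> S\<^sup>2\<close>.
\<close>

definition kruskal :: "real \<Rightarrow> (real \<times> real) set" where
  "kruskal M = {(U, V). U * V > - 2 * M}"

text \<open>Only meaningful on \<^term>\<open>kruskal M\<close>; the defining equation has no positive solution elsewhere.\<close>

definition area_radius :: "real \<Rightarrow> real \<times> real \<Rightarrow> real" where
  "area_radius M = (\<lambda>(U, V). THE r. r > 0 \<and> (r - 2 * M) * exp (r / (2 * M)) = U * V)"

definition regionII' :: "real \<Rightarrow> (real \<times> real) set" where
  "regionII' M = {(U, V) \<in> kruskal M. U > 0 \<and> V < 0}"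

definition T_reflection :: "real \<times> real \<Rightarrow> real \<times> real" where
  "T_reflection = (\<lambda>(U, V). (- V, - U))"

definition k_tilde :: "real \<Rightarrow> real \<Rightarrow> real \<Rightarrow> real" where
  "k_tilde M H r = - H * r ^ 3 + r powr (3 / 2) * (2 * M - r) powr (1 / 2)"

definition R_max :: "real \<Rightarrow> real \<Rightarrow> real" where
  "R_max M H = arg_max_on (k_tilde M H) {0<..<2 * M}"

definition C_max :: "real \<Rightarrow> real \<Rightarrow> real" where
  "C_max M H = k_tilde M H (R_max M H)"

definition r_plus :: "real \<Rightarrow> real \<Rightarrow> real \<Rightarrow> real" where
  "r_plus M H c = (THE r. r \<in> {0<..<R_max M H} \<and> k_tilde M H r = c)"

text \<open>
  The interval integral is oriented, so for \<open>r \<le> r_plus M H c\<close> it is minus the integral over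
  the interval from \<open>r\<close> to \<open>r_plus M H c\<close>. The integrand has an integrable singularity of
  inverse square root type at \<open>r_plus M H c\<close>.
\<close>

definition height :: "real \<Rightarrow> real \<Rightarrow> real \<Rightarrow> real \<Rightarrow> real" where
  "height M H c r =
     (LBINT x = r_plus M H c..r.
        x / (2 * M - x) * ((H * x ^ 3 + c) / sqrt ((H * x ^ 3 + c)\<^sup>2 + x ^ 3 * (x - 2 * M))))"

definition U_curve :: "real \<Rightarrow> real \<Rightarrow> real \<Rightarrow> real \<Rightarrow> real" where
  "U_curve M H c r = exp (- (1 / (4 * M)) * (height M H c r - r - 2 * M * ln \<bar>r - 2 * M\<bar>))"

definition V_curve :: "real \<Rightarrow> real \<Rightarrow> real \<Rightarrow> real \<Rightarrow> real" where
  "V_curve M H c r = - exp (1 / (4 * M) * (height M H c r + r + 2 * M * ln \<bar>r - 2 * M\<bar>))"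

definition half_leaf :: "real \<Rightarrow> real \<Rightarrow> real \<Rightarrow> (real \<times> real) set" where
  "half_leaf M H c = (\<lambda>r. (U_curve M H c r, V_curve M H c r)) ` {0<..r_plus M H c}"

definition Sigma_plus :: "real \<Rightarrow> real \<Rightarrow> real \<Rightarrow> (real \<times> real) set" where
  "Sigma_plus M H c =
     (if c = C_max M H then {p \<in> regionII' M. area_radius M p = R_max M H}
      else half_leaf M H c \<union> T_reflection ` half_leaf M H c)"

end

theory Submission
  imports Defs
begin

text \<open>
  A point of region II' is determined by its area radius \<open>r\<close> and its time \<open>t = 2 M ln (-V/U)\<close>; the
  reflection changes the sign of \<open>t\<close>, and the leaf with parameter \<open>c\<close> is \<open>\<bar>t\<bar> = - f(r; H, c)\<close>. Writing
  \<open>c = k(b)\<close>, where \<open>b\<close> is the largest radius on the leaf, the theorem says that for fixed \<open>r < R\<close> the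
  function \<open>b \<mapsto> - f(r; H, k(b))\<close> is a bijection from \<open>[r, R)\<close> to \<open>[0, \<infinity>)\<close>. It vanishes at \<open>b = r\<close>, is
  continuous by dominated convergence, and diverges as \<open>b\<close> tends to \<open>R\<close>, where the square root in the
  integrand acquires a simple zero. Monotonicity is the delicate point, since the integrand decreases
  in \<open>c\<close> while the interval grows. The \<open>c\<close>-derivative of the integrand is a total derivative plus a
  nonnegative remainder; this is a first integral of the Jacobi (lapse) equation of the leaves, whose
  potential, the squared second fundamental form, is nonnegative. After replacing \<open>c\<close> by \<open>k(b) + e\<close>
  the boundary terms are explicit and have a sign, and \<open>e\<close> is sent to \<open>0\<close>.
\<close>

section \<open>Integrability of the model singularity\<close>

lemma inverse_sqrt_integrable: "set_integrable lborel {0<..<A} (\<lambda>s::real. 1 / sqrt s)"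
proof (cases "A > 0")
  case True
  have "set_integrable lborel (einterval (ereal 0) (ereal A)) (\<lambda>s. 1 / sqrt s)"
  proof (rule interval_integral_FTC_nonneg(1)[where F = "\<lambda>s. 2 * sqrt s" and A = 0 and B = "2 * sqrt A"])
    show "DERIV (\<lambda>s. 2 * sqrt s) s :> 1 / sqrt s" if "ereal 0 < ereal s" for s
      using that by (auto intro!: derivative_eq_intros simp: field_simps)
    show "isCont (\<lambda>s. 1 / sqrt s) s" if "ereal 0 < ereal s" for s
      using that by (auto intro!: continuous_intros)
    show "(((\<lambda>s. 2 * sqrt s) \<circ> real_of_ereal) \<longlongrightarrow> 0) (at_right (ereal 0))"
      unfolding ereal_tendsto_simps1 by (auto intro!: tendsto_eq_intros)
    show "(((\<lambda>s. 2 * sqrt s) \<circ> real_of_ereal) \<longlongrightarrow> 2 * sqrt A) (at_left (ereal A))"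
      unfolding ereal_tendsto_simps1 by (auto intro!: tendsto_eq_intros)
  qed (use True in auto)
  then show ?thesis by (simp add: einterval_eq)
qed (simp add: set_integrable_def)

subsection \<open>The function whose level sets are the endpoints\<close>

locale kruskal_cmc =
  fixes M H :: real
  assumes M_pos: "M > 0"
begin

text \<open>\<open>k\<close> agrees with \<open>k_tilde\<close> on \<open>[0, 2 M]\<close>, and \<open>psi\<close> is chosen so that
  \<open>k' x = x\<^sup>2 * (psi x - 3 * H)\<close> with \<open>psi\<close> strictly decreasing; this locates the maximum of \<open>k\<close>.\<close>

definition a :: "real \<Rightarrow> real" where "a x = sqrt (x ^ 3 * (2 * M - x))"
definition k :: "real \<Rightarrow> real" where "k x = a x - H * x ^ 3"
definition psi :: "real \<Rightarrow> real" where "psi x = (3 * M - 2 * x) / a x"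

lemma a_pos: "0 < x \<Longrightarrow> x < 2 * M \<Longrightarrow> a x > 0"
  by (simp add: a_def)

lemma a_sq: "0 \<le> x \<Longrightarrow> x \<le> 2 * M \<Longrightarrow> (a x)\<^sup>2 = x ^ 3 * (2 * M - x)"
  by (simp add: a_def)

lemma k_tilde_eq:
  assumes "0 \<le> x" "x \<le> 2 * M"
  shows "k_tilde M H x = k x"
proof -
  have "x powr (3 / 2) = sqrt (x ^ 3)"
  proof (cases "x = 0")
    case False
    then have "x powr (3 / 2) = (x powr 3) powr (1 / 2)"
      by (simp add: powr_powr)
    also have "x powr 3 = x ^ 3"
      using powr_realpow[of x 3] assms False by simp
    finally show ?thesis
      using assms by (simp add: powr_half_sqrt)
  qed simp
  then show ?thesis
    using assms by (simp add: k_tilde_def k_def a_def powr_half_sqrt real_sqrt_mult)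
qed

lemma a_deriv:
  assumes "0 < x" "x < 2 * M"
  shows "(a has_real_derivative x\<^sup>2 * psi x) (at x)"
proof -
  have pos: "0 < x ^ 3 * (2 * M - x)" using assms by simp
  have "((\<lambda>x. x ^ 3 * (2 * M - x)) has_real_derivative (6 * M * x\<^sup>2 - 4 * x ^ 3)) (at x)"
    by (auto intro!: derivative_eq_intros simp: algebra_simps power2_eq_square power3_eq_cube)
  from DERIV_chain2[OF DERIV_real_sqrt[OF pos] this]
  have "((\<lambda>x. sqrt (x ^ 3 * (2 * M - x))) has_real_derivative
      inverse (a x) / 2 * (6 * M * x\<^sup>2 - 4 * x ^ 3)) (at x)"
    by (simp add: a_def)
  also have "inverse (a x) / 2 * (6 * M * x\<^sup>2 - 4 * x ^ 3) = x\<^sup>2 * psi x"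
    using a_pos[OF assms] by (simp add: psi_def field_simps power2_eq_square power3_eq_cube)
  finally show ?thesis by (simp add: a_def[abs_def])
qed

lemma k_deriv:
  assumes "0 < x" "x < 2 * M"
  shows "(k has_real_derivative x\<^sup>2 * (psi x - 3 * H)) (at x)"
  unfolding k_def[abs_def]
  by (auto intro!: derivative_eq_intros a_deriv assms simp: algebra_simps)

lemma a_cont: "continuous_on S a"
  unfolding a_def[abs_def] by (intro continuous_intros)

lemma k_cont: "continuous_on S k"
  unfolding k_def[abs_def] by (intro continuous_intros a_cont)

lemma psi_cont: "continuous_on {0<..<2 * M} psi"
  unfolding psi_def[abs_def] using a_pos by (intro continuous_intros a_cont) force

text \<open>The derivative of \<open>a\<close> carries the same factor \<open>3 * M - 2 * t\<close>
  as the numerator of \<open>psi\<close>. The quotient rule therefore produces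
  \<open>- 2 * a t\<close> minus a square divided by \<open>a t\<close>, which is negative.\<close>

lemma psi_strict_antimono:
  assumes "0 < x" "x < z" "z < 2 * M"
  shows "psi z < psi x"
proof -
  have "\<exists>d. (psi has_real_derivative d) (at t) \<and> d < 0" if "x \<le> t" "t \<le> z" for t
  proof -
    have t: "0 < t" "t < 2 * M" using assms that by auto
    have "a t > 0" using a_pos t by simp
    moreover have "(psi has_real_derivative (- 2 * a t - (3 * M - 2 * t) * (t\<^sup>2 * psi t)) / (a t)\<^sup>2) (at t)"
      unfolding psi_def[abs_def]
      using \<open>a t > 0\<close> a_deriv[OF t] 
      by (auto intro!: derivative_eq_intros simp: psi_def power2_eq_square)
    moreover have "(3 * M - 2 * t) * (t\<^sup>2 * psi t) = (t * (3 * M - 2 * t))\<^sup>2 / a t"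
      by (simp add: psi_def power2_eq_square)
    then have "(3 * M - 2 * t) * (t\<^sup>2 * psi t) \<ge> 0"
      using \<open>a t > 0\<close> by simp
    moreover from this have "(- 2 * a t - (3 * M - 2 * t) * (t\<^sup>2 * psi t)) / (a t)\<^sup>2 < 0"
      using \<open>a t > 0\<close> by (intro divide_neg_pos) auto
    ultimately show ?thesis by blast
  qed
  then show ?thesis
    using DERIV_neg_imp_decreasing[of x z psi] assms by blast
qed

text \<open>The denominator \<open>a\<close> tends to 0 from above at both ends of the interval,
  while the numerator of \<open>psi\<close> tends to \<open>3 * M\<close> at 0 and to
  \<open>- M\<close> at \<open>2 * M\<close>. So \<open>psi\<close> runs from plus to minus infinity
  and takes every value, in particular \<open>3 * H\<close>.\<close>

lemma ex_critical: "\<exists>R. 0 < R \<and> R < 2 * M \<and> psi R = 3 * H"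
proof -
  have a0: "filterlim a (at_right 0) (at_right 0)"
    unfolding filterlim_at
  proof
    have "(a \<longlongrightarrow> a 0) (at 0)"
      using a_cont[of UNIV] unfolding continuous_on_def by auto
    then show "(a \<longlongrightarrow> 0) (at_right 0)"
      by (auto simp: a_def filterlim_at_split)
    show "\<forall>\<^sub>F x in at_right 0. a x \<in> {0<..} \<and> a x \<noteq> 0"
      using eventually_at_right_less eventually_at_right_real[of 0 "2 * M"] a_pos M_pos
      by (auto elim!: eventually_mono) (use a_pos in force)+
  qed
  have a2: "filterlim a (at_right 0) (at_left (2 * M))"
    unfolding filterlim_at
  proof
    have "(a \<longlongrightarrow> a (2 * M)) (at (2 * M))"
      using a_cont[of UNIV] unfolding continuous_on_def by auto
    then show "(a \<longlongrightarrow> 0) (at_left (2 * M))"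
      by (auto simp: a_def filterlim_at_split)
    show "\<forall>\<^sub>F x in at_left (2 * M). a x \<in> {0<..} \<and> a x \<noteq> 0"
      using eventually_at_left_real[of 0 "2 * M"] a_pos M_pos
      by (auto elim!: eventually_mono) (use a_pos in force)+
  qed
  have "filterlim (\<lambda>x. (3 * M - 2 * x) * inverse (a x)) at_top (at_right 0)"
    by (rule filterlim_tendsto_pos_mult_at_top[where c = "3 * M"])
       (use M_pos in \<open>auto intro!: tendsto_eq_intros filterlim_compose[OF filterlim_inverse_at_top_right a0]\<close>)
  then have "\<forall>\<^sub>F x in at_right 0. psi x \<ge> 3 * H"
    by (simp add: psi_def[abs_def] divide_inverse filterlim_at_top)
  then have "\<forall>\<^sub>F x in at_right 0. psi x \<ge> 3 * H \<and> x \<in> {0<..<2 * M}"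
    using eventually_at_right_real[of 0 "2 * M"] M_pos by (auto intro: eventually_conj)
  then obtain x1 where x1: "psi x1 \<ge> 3 * H" "0 < x1" "x1 < 2 * M"
    using eventually_happens'[OF trivial_limit_at_right_real] by fastforce
  have "filterlim (\<lambda>x. (3 * M - 2 * x) * inverse (a x)) at_bot (at_left (2 * M))"
    by (rule filterlim_tendsto_neg_mult_at_bot[where c = "- M"])
       (use M_pos in \<open>auto intro!: tendsto_eq_intros filterlim_compose[OF filterlim_inverse_at_top_right a2]\<close>)
  then have "\<forall>\<^sub>F x in at_left (2 * M). psi x \<le> 3 * H"
    by (simp add: psi_def[abs_def] divide_inverse filterlim_at_bot)
  then have "\<forall>\<^sub>F x in at_left (2 * M). psi x \<le> 3 * H \<and> x \<in> {0<..<2 * M}"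
    using eventually_at_left_real[of 0 "2 * M"] M_pos by (auto intro: eventually_conj)
  then obtain x2 where x2: "psi x2 \<le> 3 * H" "0 < x2" "x2 < 2 * M"
    using eventually_happens'[OF trivial_limit_at_left_real] by fastforce
  have "x1 \<le> x2"
    using psi_strict_antimono[of x2 x1] x1 x2 by force
  moreover have "continuous_on {x1..x2} psi"
    by (rule continuous_on_subset[OF psi_cont]) (use x1 x2 in auto)
  ultimately obtain R where "x1 \<le> R" "R \<le> x2" "psi R = 3 * H"
    using IVT2'[of psi x2 "3 * H" x1] x1 x2 by blast
  then show ?thesis using x1 x2 by (intro exI[of _ R]) auto
qed

lemma
  shows R_max_pos: "0 < R_max M H" and R_max_less: "R_max M H < 2 * M"
    and psi_R_max: "psi (R_max M H) = 3 * H"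
proof -
  obtain R where R: "0 < R" "R < 2 * M" "psi R = 3 * H" using ex_critical by blast
  have less: "k x < k R" if "0 < x" "x < 2 * M" "x \<noteq> R" for x
  proof (cases "x < R")
    case True
    have "\<exists>d. (k has_real_derivative d) (at t) \<and> d > 0" if "x < t" "t < R" for t
      using k_deriv[of t] psi_strict_antimono[of t R] \<open>0 < x\<close> R that by fastforce
    then show ?thesis
      using DERIV_pos_imp_increasing_open[OF True _ k_cont] by blast
  next
    case False
    then have "R < x" using that by simp
    moreover have "\<exists>d. (k has_real_derivative d) (at t) \<and> d < 0" if "R < t" "t < x" for t
    proof -
      have "psi t - 3 * H < 0" "0 < t" "t < 2 * M"
        using psi_strict_antimono[of R t] R that \<open>x < 2 * M\<close> by auto
      then show ?thesis
        using k_deriv[of t] by (intro exI[of _ "t\<^sup>2 * (psi t - 3 * H)"]) (auto simp: mult_pos_neg)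
    qed
    ultimately show ?thesis
      using DERIV_neg_imp_decreasing_open[OF _ _ k_cont] by blast
  qed
  \<comment> \<open>\<open>arg_max_on\<close> is a choice operator, so it can be evaluated only
    because the maximum is strict: every maximizer is the critical point.\<close>
  have "R_max M H = R"
    unfolding R_max_def arg_max_on_def
  proof (rule arg_maxI[where x = R])
    show "\<not> k_tilde M H y > k_tilde M H R" if "y \<in> {0<..<2 * M}" for y
      using less[of y] that R by (cases "y = R") (auto simp: k_tilde_eq)
    show "x = R" if "x \<in> {0<..<2 * M}"
      "\<forall>y. y \<in> {0<..<2 * M} \<longrightarrow> \<not> k_tilde M H y > k_tilde M H x" for x
      using less[of x] that R by (force simp: k_tilde_eq)
  qed (use R in auto)
  then show "0 < R_max M H" "R_max M H < 2 * M" "psi (R_max M H) = 3 * H"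
    using R by auto
qed

abbreviation "R \<equiv> R_max M H"

lemma k_deriv_pos:
  assumes "0 < x" "x < R"
  shows "x\<^sup>2 * (psi x - 3 * H) > 0"
  using psi_strict_antimono[of x R] psi_R_max R_max_less assms by auto

lemma k_strict_mono:
  assumes "0 \<le> x" "x < z" "z \<le> R"
  shows "k x < k z"
proof -
  have "\<exists>d. (k has_real_derivative d) (at t) \<and> d > 0" if "x < t" "t < z" for t
    using k_deriv[of t] k_deriv_pos[of t] R_max_less assms that
    by (intro exI[of _ "t\<^sup>2 * (psi t - 3 * H)"]) auto
  then show ?thesis
    using DERIV_pos_imp_increasing_open[OF assms(2) _ k_cont] by blast
qed

lemma k_0: "k 0 = 0"
  by (simp add: k_def a_def)

lemma k_pos: "0 < x \<Longrightarrow> x \<le> R \<Longrightarrow> 0 < k x"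
  using k_strict_mono[of 0 x] k_0 by simp

lemma C_max_eq: "C_max M H = k R"
  using R_max_pos R_max_less by (simp add: C_max_def k_tilde_eq)

text \<open>With \<open>ex_k_eq\<close>, this replaces the parameter \<open>c\<close> of a leaf by
  its endpoint \<open>b\<close>, where \<open>c = k b\<close>.\<close>

lemma r_plus_k:
  assumes "0 < b" "b < R"
  shows "r_plus M H (k b) = b"
  unfolding r_plus_def
proof (rule the_equality)
  show "b \<in> {0<..<R} \<and> k_tilde M H b = k b"
    using assms R_max_less by (simp add: k_tilde_eq)
  show "r = b" if "r \<in> {0<..<R} \<and> k_tilde M H r = k b" for r
    using that assms R_max_less k_strict_mono[of r b] k_strict_mono[of b r]
    by (cases r b rule: linorder_cases) (auto simp: k_tilde_eq)
qed

lemma ex_k_eq: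
  assumes "0 < c" "c < C_max M H"
  shows "\<exists>b. 0 < b \<and> b < R \<and> k b = c"
proof -
  have "\<exists>b. 0 \<le> b \<and> b \<le> R \<and> k b = c"
    using IVT'[of k 0 c R] k_cont assms k_0 R_max_pos by (auto simp: C_max_eq)
  then obtain b where b: "0 \<le> b" "b \<le> R" "k b = c" by blast
  moreover have "b \<noteq> 0" "b \<noteq> R" using b assms k_0 by (auto simp: C_max_eq)
  ultimately show ?thesis by (intro exI[of _ b]) auto
qed

subsection \<open>The integrand of the height function\<close>

definition W :: "real \<Rightarrow> real \<Rightarrow> real" where
  "W x c = (H * x ^ 3 + c)\<^sup>2 + x ^ 3 * (x - 2 * M)"

definition g :: "real \<Rightarrow> real \<Rightarrow> real" where
  "g x c = x / (2 * M - x) * ((H * x ^ 3 + c) / sqrt (W x c))"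

text \<open>A difference of two squares. The factor \<open>c - k x\<close> carries the zero at the
  endpoint; the other factor stays positive while \<open>k x < c\<close>.\<close>

lemma W_eq:
  assumes "0 \<le> x" "x \<le> 2 * M"
  shows "W x c = (c - k x) * (c - k x + 2 * a x)"
proof -
  have "W x c = (H * x ^ 3 + c)\<^sup>2 - (a x)\<^sup>2"
    using a_sq[OF assms] by (simp add: W_def algebra_simps)
  then show ?thesis by (simp add: k_def power2_eq_square algebra_simps)
qed

lemma W_pos:
  assumes "0 < x" "x < 2 * M" "k x < c"
  shows "W x c > 0"
  using assms a_pos[of x] by (simp add: W_eq)

lemma a_less: "k x < c \<Longrightarrow> a x < H * x ^ 3 + c"
  by (simp add: k_def)

lemma g_pos:
  assumes "0 < x" "x < 2 * M" "k x < c"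
  shows "g x c > 0"
  using assms W_pos[OF assms] a_pos[of x] a_less[of x c] by (simp add: g_def)

lemma g_deriv_c:
  assumes "0 < x" "x < 2 * M" "k x < c"
  shows "((\<lambda>c. g x c) has_real_derivative - (x ^ 4 / (W x c * sqrt (W x c)))) (at c)"
proof -
  define y where "y = H * x ^ 3 + c"
  define w where "w = sqrt (W x c)"
  have pos: "0 < W x c" using W_pos assms by simp
  then have w: "w > 0" "W x c = w * w" by (auto simp: w_def)
  have "((\<lambda>c. W x c) has_real_derivative 2 * y) (at c)"
    unfolding W_def[abs_def] y_def by (auto intro!: derivative_eq_intros)
  from DERIV_chain2[where f = sqrt and g = "\<lambda>c. W x c" and x = c, OF DERIV_real_sqrt[OF pos] this]
  have sq: "((\<lambda>c. sqrt (W x c)) has_real_derivative y / w) (at c)"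
    by (rule DERIV_cong) (use w(1) in \<open>simp add: w_def[symmetric] field_simps\<close>)
  have g': "((\<lambda>c. g x c) has_real_derivative x / (2 * M - x) * ((w - y * (y / w)) / (w * w))) (at c)"
    unfolding g_def[abs_def]
    by (rule DERIV_cong, rule DERIV_cmult, rule DERIV_divide, (rule sq DERIV_add DERIV_const DERIV_ident)+)
      (use w(1) in \<open>simp_all add: w_def y_def\<close>)
  \<comment> \<open>This difference is free of \<open>c\<close>, and its factor
    \<open>2 * M - x\<close> cancels the denominator in front of \<open>g\<close>.\<close>
  have "w * w - y * y = - (x ^ 3 * (2 * M - x))"
    unfolding w(2)[symmetric] by (simp add: W_def y_def power2_eq_square algebra_simps)
  moreover have "(w - y * (y / w)) / (w * w) = (w * w - y * y) / (w * w * w)"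
    using w(1) by (simp add: field_simps)
  ultimately have "x / (2 * M - x) * ((w - y * (y / w)) / (w * w)) =
      x / (2 * M - x) * (- (x ^ 3 * (2 * M - x)) / (w * w * w))"
    by simp
  also have "\<dots> = - (x ^ 4 / (w * w * w))"
    using assms by (simp add: power3_eq_cube power4_eq_xxxx)
  finally show ?thesis using g' w(1) unfolding w(2) by simp
qed

lemma g_strict_antimono:
  assumes "0 < x" "x < 2 * M" "k x < c" "c < c'"
  shows "g x c' < g x c"
proof -
  have "\<exists>d. ((\<lambda>c. g x c) has_real_derivative d) (at t) \<and> d < 0" if "c \<le> t" "t \<le> c'" for t
  proof -
    have "k x < t" using assms that by simp
    from g_deriv_c[OF assms(1,2) this] W_pos[OF assms(1,2) this] assms(1) show ?thesis
      by (intro exI[of _ "- (x ^ 4 / (W x t * sqrt (W x t)))"]) simp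
  qed
  then show ?thesis
    by (rule DERIV_neg_imp_decreasing[OF assms(4)])
qed

text \<open>
  With \<open>w = sqrt W\<close> and the prime denoting \<open>\<partial>/\<partial>x\<close>,
  \<open>\<partial>g/\<partial>c = - x ^ 4 / w ^ 3 = B' + Q' x\<^sup>2 / (Q\<^sup>2 w)\<close>.
  The function \<open>Q\<close> comes from the lapse equation: if \<open>D' = x ^ 4 / w ^ 3\<close>, then
  \<open>(D Q + x\<^sup>2 / w)' = D Q'\<close>, and \<open>Q'\<close> is \<open>x\<^sup>2\<close> times the squared norm of the second fundamental form.
\<close>

definition Q :: "real \<Rightarrow> real \<Rightarrow> real" where
  "Q x c = 3 * H * (H * x ^ 3 + c) + M - 2 * (H * x ^ 3 + c)\<^sup>2 / x ^ 3"

definition B :: "real \<Rightarrow> real \<Rightarrow> real" where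
  "B x c = x\<^sup>2 / (Q x c * sqrt (W x c))"

lemma Q_deriv:
  assumes "x > 0"
  shows "((\<lambda>x. Q x c) has_real_derivative (3 * H\<^sup>2 * x ^ 6 + 6 * c\<^sup>2) / x ^ 4) (at x)"
proof -
  have "((\<lambda>x. Q x c) has_real_derivative
      3 * H * (3 * H * x\<^sup>2) - ((2 * (2 * (H * x ^ 3 + c) * (3 * H * x\<^sup>2))) * x ^ 3
        - 2 * (H * x ^ 3 + c)\<^sup>2 * (3 * x\<^sup>2)) / (x ^ 3 * x ^ 3)) (at x)"
    unfolding Q_def
    by (rule DERIV_cong, (rule DERIV_diff DERIV_add DERIV_cmult DERIV_divide DERIV_power DERIV_const DERIV_ident)+)
      (use assms in auto)
  moreover have "3 * H * (3 * H * x\<^sup>2) - ((2 * (2 * (H * x ^ 3 + c) * (3 * H * x\<^sup>2))) * x ^ 3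
        - 2 * (H * x ^ 3 + c)\<^sup>2 * (3 * x\<^sup>2)) / (x ^ 3 * x ^ 3) =
      (3 * H\<^sup>2 * x ^ 6 + 6 * c\<^sup>2) / x ^ 4"
  proof -
    \<comment> \<open>Denominators are cleared by hand so that a polynomial identity remains, within
      reach of \<open>algebra\<close>.\<close>
    have eq: "u - v / w = z / t" if "w \<noteq> 0" "t \<noteq> 0" "(u * w - v) * t = z * w" for u v w z t :: real
      using that by (simp add: field_simps)
    show ?thesis
    proof (rule eq)
      show "(3 * H * (3 * H * x\<^sup>2) * (x ^ 3 * x ^ 3) -
          ((2 * (2 * (H * x ^ 3 + c) * (3 * H * x\<^sup>2))) * x ^ 3
            - 2 * (H * x ^ 3 + c)\<^sup>2 * (3 * x\<^sup>2))) * x ^ 4 =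
        (3 * H\<^sup>2 * x ^ 6 + 6 * c\<^sup>2) * (x ^ 3 * x ^ 3)"
        by algebra
    qed (use assms in auto)
  qed
  ultimately show ?thesis by simp
qed

lemma Q_mono:
  assumes "0 < x" "x \<le> z"
  shows "Q x c \<le> Q z c"
proof (rule DERIV_nonneg_imp_nondecreasing[OF assms(2)])
  show "\<exists>d. ((\<lambda>x. Q x c) has_real_derivative d) (at t) \<and> 0 \<le> d" if "x \<le> t" for t
    using Q_deriv[of t c] assms that
    by (intro exI[of _ "(3 * H\<^sup>2 * t ^ 6 + 6 * c\<^sup>2) / t ^ 4"]) auto
qed

lemma B_deriv:
  assumes "0 < x" "x < 2 * M" "k x < c" "Q x c \<noteq> 0"
  shows "((\<lambda>x. B x c) has_real_derivative - (x ^ 4 / (W x c * sqrt (W x c)))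
           - (3 * H\<^sup>2 * x ^ 6 + 6 * c\<^sup>2) / x ^ 4 * x\<^sup>2 / ((Q x c)\<^sup>2 * sqrt (W x c))) (at x)"
proof -
  define q where "q = 3 * H * x\<^sup>2 * (H * x ^ 3 + c) - 3 * M * x\<^sup>2 + 2 * x ^ 3"
  define w where "w = sqrt (W x c)"
  define Q' where "Q' = (3 * H\<^sup>2 * x ^ 6 + 6 * c\<^sup>2) / x ^ 4"
  have pos: "0 < W x c" using W_pos assms by simp
  then have w: "w > 0" "W x c = w * w" by (auto simp: w_def)
  have "((\<lambda>x. W x c) has_real_derivative 2 * q) (at x)"
    unfolding W_def q_def
    by (auto intro!: derivative_eq_intros simp: algebra_simps power2_eq_square power3_eq_cube)
  from DERIV_chain2[where f = sqrt and g = "\<lambda>x. W x c" and x = x, OF DERIV_real_sqrt[OF pos] this]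
  have sq: "((\<lambda>x. sqrt (W x c)) has_real_derivative q / w) (at x)"
    by (rule DERIV_cong) (use w(1) in \<open>simp add: w_def[symmetric] field_simps\<close>)
  \<comment> \<open>This identity explains the choice of \<open>Q\<close> and \<open>B\<close>: the
    term \<open>2 * W x c / x\<close> cancels the derivative of the factor \<open>x\<^sup>2\<close>
    in \<open>B\<close>, and \<open>x\<^sup>2 * Q x c\<close> yields exactly
    \<open>- x ^ 4 / w ^ 3\<close>.\<close>
  have q_eq: "q = x\<^sup>2 * Q x c + 2 * W x c / x"
    using assms by (simp add: q_def Q_def W_def field_simps power2_eq_square power3_eq_cube)
  have B': "((\<lambda>x. B x c) has_real_derivative
      (2 * x * (Q x c * w) - x\<^sup>2 * (Q' * w + Q x c * (q / w))) / ((Q x c * w) * (Q x c * w))) (at x)"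
    unfolding B_def
    by (rule DERIV_cong, rule DERIV_divide, (rule DERIV_power DERIV_ident DERIV_mult sq Q_deriv assms)+)
       (use assms w(1) in \<open>auto simp: Q'_def w_def algebra_simps\<close>)
  have "(2 * x * (q0 * w) - x\<^sup>2 * (Q' * w + q0 * ((x\<^sup>2 * q0 + 2 * (w * w) / x) / w))) / ((q0 * w) * (q0 * w)) =
      - (x ^ 4 / (w * w * w)) - Q' * x\<^sup>2 / (q0\<^sup>2 * w)" if "q0 \<noteq> 0" for q0
    using w(1) assms(1) that
    by (simp add: divide_simps) (simp add: algebra_simps eval_nat_numeral)
  from this[OF assms(4)] B' show ?thesis
    unfolding q_eq Q'_def w_def[symmetric] unfolding w(2) by simp
qed

section \<open>Signs at the endpoint\<close>

text \<open>For \<open>e = 0\<close> both sides agree: up to sign they are half the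
  \<open>x\<close>-derivative of \<open>W\<close> at its zero. The excess for \<open>e > 0\<close>
  is \<open>e * (4 * a b / b - 3 * H * b\<^sup>2) + 2 * e\<^sup>2 / b\<close>, whose bracket is
  nonnegative because \<open>3 * H < psi b\<close> and
  \<open>b\<^sup>2 * psi b \<le> 4 * a b / b\<close>.\<close>

lemma Q_endpoint:
  assumes "0 < b" "b < R" "e \<ge> 0"
  shows "a b * (b\<^sup>2 * (psi b - 3 * H)) \<le> - (b\<^sup>2 * Q b (k b + e))"
proof -
  have b: "0 < b" "b < 2 * M" using assms R_max_less by auto
  have ab: "a b > 0" using a_pos b by simp
  have a2: "a b * a b = b * b * b * (2 * M - b)"
    using a_sq[of b] b by (simp add: power2_eq_square power3_eq_cube)
  have psi: "psi b * a b = 3 * M - 2 * b" using ab by (simp add: psi_def)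
  have "b\<^sup>2 * psi b \<le> 4 * a b / b"
  proof -
    have "b ^ 3 * (psi b * a b) \<le> 4 * (a b * a b)"
      unfolding psi a2 using b by (simp add: power3_eq_cube mult_left_mono)
    then have "(b ^ 3 * psi b) * a b \<le> (4 * a b) * a b" by (simp add: mult.assoc)
    then have "b ^ 3 * psi b \<le> 4 * a b" using ab by simp
    then show ?thesis using b by (simp add: field_simps power2_eq_square power3_eq_cube)
  qed
  then have "0 \<le> 4 * a b / b - 3 * H * b\<^sup>2"
    using k_deriv_pos[OF assms(1,2)] by (simp add: algebra_simps)
  then have "0 \<le> e * (4 * a b / b - 3 * H * b\<^sup>2) + 2 * e\<^sup>2 / b"
    using assms by simp
  moreover have "- (b\<^sup>2 * Q b (k b + e)) =
      a b * (b\<^sup>2 * (psi b - 3 * H)) + (e * (4 * a b / b - 3 * H * b\<^sup>2) + 2 * e\<^sup>2 / b)"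
  proof -
    have "H * b ^ 3 + (k b + e) = a b + e" by (simp add: k_def)
    then have "- (b\<^sup>2 * Q b (k b + e)) =
        2 * (a b * a b) / b - 3 * H * b\<^sup>2 * (a b + e) - M * b\<^sup>2 + 4 * a b * e / b + 2 * e\<^sup>2 / b"
      using b by (simp add: Q_def field_simps power2_eq_square power3_eq_cube)
    also have "2 * (a b * a b) / b = b\<^sup>2 * (4 * M - 2 * b)"
      unfolding a2 using b by (simp add: field_simps power2_eq_square)
    finally have "- (b\<^sup>2 * Q b (k b + e)) = b\<^sup>2 * (psi b * a b) - 3 * H * b\<^sup>2 * (a b + e) 
        + 4 * a b * e / b + 2 * e\<^sup>2 / b"
      unfolding psi by (simp add: algebra_simps)
    then show ?thesis by (simp add: algebra_simps)
  qed
  ultimately show ?thesis by simp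
qed

text \<open>\<open>Q\<close> increases with \<open>x\<close>, so its sign at the endpoint decides.
  In particular \<open>B\<close> has no pole from \<open>Q\<close> on the range of
  integration.\<close>

lemma Q_neg:
  assumes "0 < x" "x \<le> b" "b < R" "k b \<le> c"
  shows "Q x c < 0"
proof -
  have b: "0 < b" "b < 2 * M" using assms R_max_less by auto
  have "0 < a b * (b\<^sup>2 * (psi b - 3 * H))"
    using a_pos[OF b] k_deriv_pos[of b] b assms by simp
  then have "b\<^sup>2 * Q b c < 0"
    using Q_endpoint[of b "c - k b"] b assms by simp
  then have "Q b c < 0" using b by (simp add: mult_less_0_iff)
  then show ?thesis using Q_mono[of x b c] assms by simp
qed

text \<open>Both summands blow up as \<open>c\<close> decreases to \<open>k b\<close>, with opposite signs.\<close>

lemma boundary_term_nonneg: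
  assumes "0 < b" "b < R" "k b < c"
  shows "0 \<le> g b c + b\<^sup>2 * (psi b - 3 * H) * B b c"
proof -
  have b: "0 < b" "b < 2 * M" using assms R_max_less by auto
  define y where "y = H * b ^ 3 + c"
  define k' where "k' = b\<^sup>2 * (psi b - 3 * H)"
  define N where "N = - (b\<^sup>2 * Q b c)"
  have w: "sqrt (W b c) > 0" using W_pos b assms by simp
  have ab: "a b > 0" using a_pos b by simp
  have k': "k' > 0" using k_deriv_pos assms by (simp add: k'_def)
  have N: "a b * k' \<le> N" using Q_endpoint[of b "c - k b"] assms by (simp add: k'_def N_def)
  have y: "a b \<le> y" using a_less[OF assms(3)] by (simp add: y_def)
  have Npos: "N > 0" using N ab k' by (meson less_le_trans mult_pos_pos)
  \<comment> \<open>The product of the two bounds is what the numerator needs once both summands are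
    put over a common denominator.\<close>
  have "a b * (a b * k') \<le> y * N" 
    using N y ab k' by (intro mult_mono) auto
  then have le: "k' * (a b)\<^sup>2 \<le> y * N" by (simp add: power2_eq_square mult_ac)
  have "g b c = b ^ 4 * y / ((a b)\<^sup>2 * sqrt (W b c))"
    using a_sq[of b] b unfolding g_def y_def[symmetric]
    by (simp add: power3_eq_cube power4_eq_xxxx)
  moreover have "B b c = - (b ^ 4 / (N * sqrt (W b c)))"
    using b Npos by (simp add: B_def N_def field_simps power2_eq_square power4_eq_xxxx)
  moreover have "p * y / (A * w) + k' * - (p / (N * w)) = p * (y * N - k' * A) / (A * N * w)"
    if "A > 0" "w > 0" for p A w :: real
    using that Npos by (simp add: divide_simps) (simp add: algebra_simps)
  from this[of "(a b)\<^sup>2", OF _ w] ab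
  have "b ^ 4 * y / ((a b)\<^sup>2 * sqrt (W b c)) + k' * - (b ^ 4 / (N * sqrt (W b c))) =
      b ^ 4 * (y * N - k' * (a b)\<^sup>2) / ((a b)\<^sup>2 * N * sqrt (W b c))"
    by simp
  ultimately have "g b c + k' * B b c =
      b ^ 4 * (y * N - k' * (a b)\<^sup>2) / ((a b)\<^sup>2 * N * sqrt (W b c))"
    by simp
  also have "\<dots> \<ge> 0" using le ab Npos w by simp
  finally show ?thesis by (simp add: k'_def)
qed

section \<open>Derivatives of the integral in the parameter and in the endpoint\<close>

lemma W_cont: "continuous_on S (\<lambda>(c, x). W x c)"
  unfolding W_def case_prod_beta by (intro continuous_intros)

lemma g_cont:
  assumes "\<And>c x. (c, x) \<in> S \<Longrightarrow> 0 < x \<and> x < 2 * M \<and> k x < c"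
  shows "continuous_on S (\<lambda>(c, x). g x c)"
proof -
  have "2 * M - snd p \<noteq> 0" "sqrt (W (snd p) (fst p)) \<noteq> 0" if "p \<in> S" for p
    using assms[of "fst p" "snd p"] W_pos[of "snd p" "fst p"] that by auto
  then show ?thesis
    unfolding g_def case_prod_beta
    by (intro continuous_intros W_cont[unfolded case_prod_beta]) auto
qed

lemma g_cont':
  assumes "\<And>x. x \<in> S \<Longrightarrow> 0 < x \<and> x < 2 * M \<and> k x < c"
  shows "continuous_on S (\<lambda>x. g x c)"
proof -
  have "continuous_on ({c} \<times> S) (\<lambda>(c, x). g x c)"
    by (rule g_cont) (use assms in auto)
  moreover have "continuous_on S (\<lambda>x. (c, x))" by (intro continuous_intros)
  ultimately have "continuous_on S (\<lambda>x. (\<lambda>(c, x). g x c) (c, x))"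
    by (rule continuous_on_compose2) auto
  then show ?thesis by simp
qed

lemma between_k_less:
  assumes "0 < r" "r \<le> x" "x \<le> b" "b < R" "k b < c"
  shows "0 < x" "x < 2 * M" "k x < c"
  using assms R_max_less k_strict_mono[of x b] by (auto simp: order.order_iff_strict)

text \<open>For \<open>c > k b\<close> the integrand is smooth up to and including \<open>b\<close>,
  so the Leibniz rule applies. The parameters range over an open half-line, which turns the
  derivative within it into a full one.\<close>

lemma integral_deriv_c:
  assumes "0 < r" "b < R" "k b < c"
  shows "((\<lambda>c. integral {r..b} (\<lambda>x. g x c)) has_real_derivative
           integral {r..b} (\<lambda>x. - (x ^ 4 / (W x c * sqrt (W x c))))) (at c)"
proof -
  have *: "0 < x" "x < 2 * M" "k x < c'" if "x \<in> {r..b}" "c' \<in> {k b<..}" for x c'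
    using between_k_less[of r x b c'] assms that by auto
  have "((\<lambda>c. integral (cbox r b) (\<lambda>x. g x c)) has_real_derivative
           integral (cbox r b) (\<lambda>x. - (x ^ 4 / (W x c * sqrt (W x c))))) (at c within {k b<..})"
  proof (rule leibniz_rule_field_derivative[where f = "\<lambda>c x. g x c"
        and fx = "\<lambda>c x. - (x ^ 4 / (W x c * sqrt (W x c)))"])
    show "((\<lambda>c. g x c) has_real_derivative - (x ^ 4 / (W x c * sqrt (W x c)))) (at c within {k b<..})"
      if "c \<in> {k b<..}" "x \<in> cbox r b" for c x
      using that *[of x c] by (simp add: has_field_derivative_at_within[OF g_deriv_c])
    show "(\<lambda>x. g x c) integrable_on cbox r b" if "c \<in> {k b<..}" for c
      unfolding cbox_interval
    proof (intro integrable_continuous_interval g_cont')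
      show "0 < x \<and> x < 2 * M \<and> k x < c" if "x \<in> {r..b}" for x
        using *[of x c] that \<open>c \<in> {k b<..}\<close> by simp
    qed
    have "W (snd p) (fst p) * sqrt (W (snd p) (fst p)) \<noteq> 0" if "p \<in> {k b<..} \<times> cbox r b" for p
      using *[of "snd p" "fst p"] W_pos[of "snd p" "fst p"] that by (auto simp: mem_Times_iff)
    then show "continuous_on ({k b<..} \<times> cbox r b) (\<lambda>(c, x). - (x ^ 4 / (W x c * sqrt (W x c))))"
      unfolding case_prod_beta
      by (intro continuous_intros W_cont[unfolded case_prod_beta]) auto
  qed (use assms in auto)
  then show ?thesis
    using assms at_within_open[of c "{k b<..}"] by simp
qed

text \<open>Integrating the total derivative gives \<open>B b c - B r c\<close> plus the integral of
  a nonnegative remainder. Both discarded contributions are nonnegative, since \<open>Q < 0\<close>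
  forces \<open>B r c \<le> 0\<close>.\<close>

lemma integral_deriv_c_ge:
  assumes "0 < r" "r \<le> b" "b < R" "k b < c"
  shows "B b c \<le> integral {r..b} (\<lambda>x. - (x ^ 4 / (W x c * sqrt (W x c))))"
proof -
  let ?E = "\<lambda>x. (3 * H\<^sup>2 * x ^ 6 + 6 * c\<^sup>2) / x ^ 4 * x\<^sup>2 / ((Q x c)\<^sup>2 * sqrt (W x c))"
  let ?D = "\<lambda>x. - (x ^ 4 / (W x c * sqrt (W x c)))"
  have *: "0 < x" "x < 2 * M" "k x < c" "Q x c < 0" if "x \<in> {r..b}" for x
    using between_k_less[of r x b c] Q_neg[of x b c] assms that by auto
  have B': "((\<lambda>x. ?D x - ?E x) has_integral B b c - B r c) {r..b}"
  proof (rule fundamental_theorem_of_calculus)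
    show "((\<lambda>x. B x c) has_vector_derivative ?D x - ?E x) (at x within {r..b})"
      if "x \<in> {r..b}" for x
    proof -
      have "((\<lambda>x. B x c) has_real_derivative ?D x - ?E x) (at x)"
        by (rule B_deriv) (use *[OF that] in simp_all)
      then show ?thesis
        by (auto dest: has_field_derivative_at_within
            simp only: has_real_derivative_iff_has_vector_derivative[symmetric])
    qed
  qed (use assms in auto)
  have "W x c * sqrt (W x c) \<noteq> 0" if "x \<in> {r..b}" for x
    using *[OF that] W_pos[of x c] by auto
  then have "?D integrable_on {r..b}"
    unfolding W_def by (intro integrable_continuous_interval continuous_intros) auto
  moreover have "?D x - ?E x \<le> ?D x" if "x \<in> {r..b}" for x
    using W_pos[of x c] *[OF that] by simp
  ultimately have "integral {r..b} (\<lambda>x. ?D x - ?E x) \<le> integral {r..b} ?D"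
    using B' by (intro integral_le) auto
  moreover have "B r c \<le> 0"
    using *[of r] W_pos[of r c] assms by (simp add: B_def divide_le_0_iff mult_le_0_iff)
  ultimately show ?thesis using integral_unique[OF B'] by simp
qed

lemma integral_deriv:
  assumes "0 < r" "r < b" "b < R" "k b < c"
  shows "((\<lambda>(c, b). integral {r..b} (\<lambda>x. g x c)) has_derivative
      (\<lambda>(s, t). integral {r..b} (\<lambda>x. - (x ^ 4 / (W x c * sqrt (W x c)))) * s + g b c * t)) (at (c, b))"
proof -
  \<comment> \<open>The upper limit must be free to move to both sides of \<open>b\<close>; a point
    \<open>z\<close> beyond \<open>b\<close> with \<open>k z < c\<close> leaves a neighbourhood of
    \<open>(c, b)\<close> on which the integrand is regular.\<close>
  have "(k \<longlongrightarrow> k b) (at_right b)"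
    using k_cont[of UNIV] by (auto simp: continuous_on_def intro: filterlim_mono at_le)
  then have "\<forall>\<^sub>F z in at_right b. k z < c \<and> z \<in> {b<..<R}"
    using assms eventually_at_right_real[of b R] by (intro eventually_conj order_tendstoD(2)) auto
  then obtain z where z: "k z < c" "b < z" "z < R"
    using eventually_happens'[OF trivial_limit_at_right_real] by fastforce
  let ?X = "{k z<..}" and ?Y = "{r<..<z}"
  let ?D = "integral {r..b} (\<lambda>x. - (x ^ 4 / (W x c * sqrt (W x c))))"
  have dom: "0 < x \<and> x < 2 * M \<and> k x \<le> k z" if "r \<le> x" "x \<le> z" for x
    using k_strict_mono[of x z] R_max_less assms z that by (cases "x = z") auto
  have "((\<lambda>(c, b). integral {r..b} (\<lambda>x. g x c)) has_derivative
      (\<lambda>(s, t). ?D * s + blinfun_mult_right (g b c) t)) (at (c, b) within ?X \<times> ?Y)"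
  \<comment> \<open>The rule is asymmetric: the \<open>c\<close>-derivative is required at one point
    only, the \<open>b\<close>-derivative on a neighbourhood and continuous there, hence its form as
    a bounded linear function.\<close>
  proof (rule has_derivative_partialsI[where fy = "\<lambda>c b. blinfun_mult_right (g b c)"])
    show "((\<lambda>c. integral {r..b} (\<lambda>x. g x c)) has_derivative (\<lambda>s. ?D * s)) (at c within ?X)"
      using has_field_derivative_at_within[OF integral_deriv_c[OF assms(1,3,4)]]
      unfolding has_field_derivative_def .
    show "((\<lambda>b. integral {r..b} (\<lambda>x. g x c')) has_derivative blinfun_mult_right (g b' c')) (at b' within ?Y)"
      if "c' \<in> ?X" "b' \<in> ?Y" for c' b'
    proof -
      have "continuous_on {r..z} (\<lambda>x. g x c')"
        by (rule g_cont') (use dom that in force)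
      from integral_has_real_derivative[OF this, of b'] that
      have "((\<lambda>b. integral {r..b} (\<lambda>x. g x c')) has_real_derivative g b' c') (at b' within {r..z})"
        by simp
      then have "((\<lambda>b. integral {r..b} (\<lambda>x. g x c')) has_real_derivative g b' c') (at b' within ?Y)"
        by (rule DERIV_subset) auto
      then show ?thesis by (simp add: has_field_derivative_def)
    qed
    have "continuous_on (?X \<times> ?Y) (\<lambda>(c, b). g b c)"
    proof (rule g_cont)
      show "0 < x \<and> x < 2 * M \<and> k x < c" if "(c, x) \<in> ?X \<times> ?Y" for c x
        using dom[of x] that by simp
    qed
    then have "continuous_on (?X \<times> ?Y) (\<lambda>p. blinfun_mult_right (g (snd p) (fst p)))"
      by (intro bounded_linear.continuous_on[OF bounded_linear_blinfun_mult_right])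
        (simp add: case_prod_beta)
    then show "continuous (at (c, b) within ?X \<times> ?Y) (\<lambda>(c, b). blinfun_mult_right (g b c))"
      using assms z unfolding continuous_on_eq_continuous_within case_prod_beta by auto
  qed (use assms z in auto)
  moreover have "at (c, b) within ?X \<times> ?Y = at (c, b)"
    using assms z by (intro at_within_open open_Times) auto
  ultimately show ?thesis by simp
qed

text \<open>Parametrising by the endpoint \<open>b\<close> with \<open>c = k b + e\<close> keeps the integrand smooth up to \<open>b\<close>.\<close>

lemma integral_endpoint_mono:
  assumes "0 < r" "r < b1" "b1 \<le> b2" "b2 < R" "0 < e"
  shows "integral {r..b1} (\<lambda>x. g x (k b1 + e)) \<le> integral {r..b2} (\<lambda>x. g x (k b2 + e))"
proof (rule DERIV_nonneg_imp_nondecreasing[OF assms(3)])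
  fix b assume b: "b1 \<le> b" "b \<le> b2"
  define k' where "k' = b\<^sup>2 * (psi b - 3 * H)"
  define D where "D = integral {r..b} (\<lambda>x. - (x ^ 4 / (W x (k b + e) * sqrt (W x (k b + e)))))"
  have "(k has_real_derivative k') (at b)"
    using k_deriv[of b] b assms R_max_less by (simp add: k'_def)
  then have "((\<lambda>b. (k b + e, b)) has_derivative (\<lambda>t. (k' * t, t))) (at b)"
    unfolding has_field_derivative_def by (auto intro!: derivative_eq_intros)
  moreover have "((\<lambda>(c, b). integral {r..b} (\<lambda>x. g x c)) has_derivative
      (\<lambda>(s, t). D * s + g b (k b + e) * t)) (at (k b + e, b))"
    using integral_deriv[of r b "k b + e"] b assms by (simp add: D_def)
  ultimately have "((\<lambda>b. (\<lambda>(c, b). integral {r..b} (\<lambda>x. g x c)) (k b + e, b)) has_derivative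
      (\<lambda>t. (\<lambda>(s, t). D * s + g b (k b + e) * t) (k' * t, t))) (at b)"
    by (rule has_derivative_compose)
  then have "((\<lambda>b. integral {r..b} (\<lambda>x. g x (k b + e))) has_real_derivative
      k' * D + g b (k b + e)) (at b)"
    unfolding has_field_derivative_def prod.case
    by (rule has_derivative_eq_rhs) (simp add: fun_eq_iff algebra_simps)
  moreover have "0 \<le> k' * D + g b (k b + e)"
  proof -
    have "B b (k b + e) \<le> D"
      using integral_deriv_c_ge[of r b "k b + e"] b assms by (simp add: D_def)
    moreover have "0 \<le> k'" using k_deriv_pos[of b] b assms by (simp add: k'_def)
    ultimately have "k' * B b (k b + e) \<le> k' * D" by (rule mult_left_mono)
    moreover have "0 \<le> g b (k b + e) + k' * B b (k b + e)"
      using boundary_term_nonneg[of b "k b + e"] b assms by (simp add: k'_def)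
    ultimately show ?thesis by linarith
  qed
  ultimately show "\<exists>d. ((\<lambda>b. integral {r..b} (\<lambda>x. g x (k b + e))) has_real_derivative d) (at b) \<and> 0 \<le> d"
    by blast
qed

section \<open>A bound near the endpoint, uniform in the leaf\<close>

text \<open>In the factorisation of \<open>W x (k b)\<close> the first factor is at least
  \<open>\<mu> * (b - x)\<close> by the mean value theorem, the second at least
  \<open>2 * \<alpha>\<close>. Both constants come from compactness of the interval from
  \<open>r\<close> to \<open>\<beta>\<close>, so one \<open>K\<close> serves all
  \<open>b \<le> \<beta>\<close>; this uniformity is what \<open>leaf_time_cont\<close>
  uses.\<close>

lemma g_bound:
  assumes "0 < r" "\<beta> < R"
  shows "\<exists>K. \<forall>b x. r \<le> x \<and> x < b \<and> b \<le> \<beta> \<longrightarrow> g x (k b) \<le> K / sqrt (b - x)"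
proof (cases "r \<le> \<beta>")
  case True
  have sub: "0 < x \<and> x < R \<and> x < 2 * M" if "x \<in> {r..\<beta>}" for x
    using assms R_max_less that by auto
  have "continuous_on {r..\<beta>} (\<lambda>x. x\<^sup>2 * (psi x - 3 * H))"
    by (intro continuous_intros continuous_on_subset[OF psi_cont]) (use sub in auto)
  from continuous_attains_inf[OF _ _ this] True obtain x1 where x1: "x1 \<in> {r..\<beta>}"
    "\<And>x. x \<in> {r..\<beta>} \<Longrightarrow> x1\<^sup>2 * (psi x1 - 3 * H) \<le> x\<^sup>2 * (psi x - 3 * H)" by auto
  define \<mu> where "\<mu> = x1\<^sup>2 * (psi x1 - 3 * H)"
  have \<mu>: "\<mu> > 0" using k_deriv_pos sub[OF x1(1)] by (simp add: \<mu>_def)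
  from continuous_attains_inf[OF _ _ a_cont[of "{r..\<beta>}"]] True obtain x2 where x2: "x2 \<in> {r..\<beta>}"
    "\<And>x. x \<in> {r..\<beta>} \<Longrightarrow> a x2 \<le> a x" by auto
  define \<alpha> where "\<alpha> = a x2"
  have \<alpha>: "\<alpha> > 0" using a_pos sub[OF x2(1)] by (simp add: \<alpha>_def)
  define Y where "Y = \<bar>H\<bar> * (2 * M) ^ 3 + k \<beta>"
  define K where "K = 2 * M / (2 * M - \<beta>) * (Y / sqrt (2 * \<alpha> * \<mu>))"
  have "g x (k b) \<le> K / sqrt (b - x)" if "r \<le> x" "x < b" "b \<le> \<beta>" for b x
  proof -
    have x: "x \<in> {r..\<beta>}" "0 < x" "x < 2 * M" "\<beta> < 2 * M"
      using that sub[of x] sub[of \<beta>] True by auto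
    have kxb: "k x < k b" using k_strict_mono[of x b] that assms by simp
    have ax: "a x > 0" using a_pos x by simp
    have "\<exists>z. x < z \<and> z < b \<and> k b - k x = (b - x) * (z\<^sup>2 * (psi z - 3 * H))"
      by (rule MVT2) (use that sub in \<open>auto intro!: k_deriv\<close>)
    then obtain z where z: "x < z" "z < b" "k b - k x = (b - x) * (z\<^sup>2 * (psi z - 3 * H))"
      by blast
    have "\<mu> \<le> z\<^sup>2 * (psi z - 3 * H)" using x1(2)[of z] z that by (simp add: \<mu>_def)
    then have "(b - x) * \<mu> \<le> k b - k x" unfolding z(3) using that by (intro mult_left_mono) auto
    moreover have "2 * \<alpha> \<le> k b - k x + 2 * a x"
      using kxb x2(2)[OF x(1)] by (simp add: \<alpha>_def)
    ultimately have "(b - x) * \<mu> * (2 * \<alpha>) \<le> W x (k b)"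
      unfolding W_eq[OF less_imp_le[OF x(2)] less_imp_le[OF x(3)]]
      using kxb \<alpha> \<mu> that by (intro mult_mono) auto
    then have "sqrt (2 * \<alpha> * \<mu> * (b - x)) \<le> sqrt (W x (k b))" by (simp add: mult_ac)
    then have w: "sqrt (2 * \<alpha> * \<mu>) * sqrt (b - x) \<le> sqrt (W x (k b))" 
      by (simp add: real_sqrt_mult)
    have pos: "0 < sqrt (2 * \<alpha> * \<mu>) * sqrt (b - x)" using \<alpha> \<mu> that by simp
    have y0: "0 < H * x ^ 3 + k b" using a_less[OF kxb] ax by simp
    have "H * x ^ 3 \<le> \<bar>H\<bar> * (2 * M) ^ 3"
      using x by (intro mult_mono power_mono) auto
    moreover have "k b \<le> k \<beta>"
      using k_strict_mono[of b \<beta>] that x assms by (cases "b = \<beta>") auto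
    ultimately have yY: "H * x ^ 3 + k b \<le> Y" by (simp add: Y_def)
    have "(H * x ^ 3 + k b) / sqrt (W x (k b)) \<le> Y / (sqrt (2 * \<alpha> * \<mu>) * sqrt (b - x))"
      using yY y0 w pos by (intro frac_le) auto
    moreover have "x / (2 * M - x) \<le> 2 * M / (2 * M - \<beta>)"
      using x by (intro frac_le) auto
    ultimately have "g x (k b) \<le> 2 * M / (2 * M - \<beta>) * (Y / (sqrt (2 * \<alpha> * \<mu>) * sqrt (b - x)))"
      unfolding g_def using x y0 W_pos[of x "k b"] kxb M_pos by (intro mult_mono) auto
    then show ?thesis by (simp add: K_def)
  qed
  then show ?thesis by blast
qed (auto intro: exI[of _ 0])

subsection \<open>The time function of the leaves\<close>

text \<open>The Schwarzschild time, up to sign, of the point at radius \<open>r\<close> on the leaf whose symmetric point is at radius \<open>b\<close>.\<close>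

definition leaf_time :: "real \<Rightarrow> real \<Rightarrow> real" where
  "leaf_time r b = (LBINT x:{r<..<b}. g x (k b))"

lemma g_cont_Ioo:
  assumes "0 < r" "b < R" "k b \<le> c"
  shows "continuous_on {r<..<b} (\<lambda>x. g x c)"
proof (rule g_cont')
  show "0 < x \<and> x < 2 * M \<and> k x < c" if "x \<in> {r<..<b}" for x
    using k_strict_mono[of x b] R_max_less assms that by auto
qed

lemma g_integrable:
  assumes "0 < r" "b < R"
  shows "set_integrable lborel {r<..<b} (\<lambda>x. g x (k b))"
proof -
  obtain K where K: "\<And>x. r \<le> x \<Longrightarrow> x < b \<Longrightarrow> g x (k b) \<le> K / sqrt (b - x)"
    using g_bound[OF assms] by blast
  have "integrable lborel (\<lambda>x. indicator {0<..<b - r} (b + (- 1) * x) *\<^sub>R (1 / sqrt (b + (- 1) * x)))"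
    by (rule lborel_integrable_real_affine) (use inverse_sqrt_integrable in \<open>auto simp: set_integrable_def\<close>)
  also have "(\<lambda>x. indicator {0<..<b - r} (b + (- 1) * x) *\<^sub>R (1 / sqrt (b + (- 1) * x))) =
      (\<lambda>x. indicator {r<..<b} x *\<^sub>R (1 / sqrt (b - x)))"
    by (auto simp: indicator_def)
  finally have "set_integrable lborel {r<..<b} (\<lambda>x. K * (1 / sqrt (b - x)))"
    by (intro set_integrable_mult_right) (simp add: set_integrable_def)
  then show ?thesis
  proof (rule set_integrable_bound)
    show "set_borel_measurable lborel {r<..<b} (\<lambda>x. g x (k b))"
      using borel_measurable_continuous_on_indicator[OF _ g_cont_Ioo[of r b "k b"]] assms
      by (simp add: set_borel_measurable_def)
    show "AE x in lborel. x \<in> {r<..<b} \<longrightarrow> norm (g x (k b)) \<le> norm (K * (1 / sqrt (b - x)))"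
    proof (rule AE_I2, rule impI)
      fix x assume x: "x \<in> {r<..<b}"
      have "0 < g x (k b)"
        using g_pos[of x "k b"] k_strict_mono[of x b] x assms R_max_less by auto
      then show "norm (g x (k b)) \<le> norm (K * (1 / sqrt (b - x)))"
        using K[of x] x divide_right_mono[OF abs_ge_self[of K], of "sqrt (b - x)"] by (auto simp: abs_mult)
    qed
  qed
qed

section \<open>Monotonicity of the leaf time\<close>

text \<open>The limit of \<open>integral_endpoint_mono\<close> as \<open>e\<close> tends to 0. Since
  \<open>g\<close> is positive and decreases in \<open>c\<close>, the singular integrand
  \<open>g x (k b)\<close> itself dominates the regularised ones.\<close>

lemma leaf_time_mono:
  assumes "0 < r" "r < b1" "b1 \<le> b2" "b2 < R"
  shows "leaf_time r b1 \<le> leaf_time r b2"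
proof -
  define e :: "nat \<Rightarrow> real" where "e n = inverse (real (Suc n))" for n
  have e: "e n > 0" for n by (simp add: e_def)
  have e0: "e \<longlonglongrightarrow> 0"
    unfolding e_def[abs_def] by (rule LIMSEQ_inverse_real_of_nat)
  have lim: "(\<lambda>n. integral {r..b} (\<lambda>x. g x (k b + e n))) \<longlonglongrightarrow> leaf_time r b" if b: "r < b" "b < R" for b
  proof -
    have dom: "0 < x" "x < 2 * M" "k x < k b" if "x \<in> {r<..<b}" for x
      using k_strict_mono[of x b] R_max_less assms b that by auto
    have meas: "(\<lambda>x. indicator {r<..<b} x *\<^sub>R g x c) \<in> borel_measurable lborel" if "k b \<le> c" for c
      using borel_measurable_continuous_on_indicator[OF _ g_cont_Ioo[of r b c]] assms b that by simp
    have "(\<lambda>n. LBINT x:{r<..<b}. g x (k b + e n)) \<longlonglongrightarrow> (LBINT x:{r<..<b}. g x (k b))"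
      unfolding set_lebesgue_integral_def
    proof (rule integral_dominated_convergence[where w = "\<lambda>x. indicator {r<..<b} x *\<^sub>R g x (k b)"])
      show "integrable lborel (\<lambda>x. indicator {r<..<b} x *\<^sub>R g x (k b))"
        using g_integrable[of r b] assms b by (simp add: set_integrable_def)
      show "AE x in lborel. (\<lambda>n. indicator {r<..<b} x *\<^sub>R g x (k b + e n))
          \<longlonglongrightarrow> indicator {r<..<b} x *\<^sub>R g x (k b)"
      proof (rule AE_I2)
        fix x
        have "(\<lambda>n. g x (k b + e n)) \<longlonglongrightarrow> g x (k b)" if "x \<in> {r<..<b}"
        proof (rule isCont_tendsto_compose[where g = "\<lambda>c. g x c"])
          show "isCont (\<lambda>c. g x c) (k b)"
            using DERIV_isCont[OF g_deriv_c[OF dom[OF that]]] .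
          show "(\<lambda>n. k b + e n) \<longlonglongrightarrow> k b"
            using tendsto_add[OF tendsto_const e0] by simp
        qed
        then show "(\<lambda>n. indicator {r<..<b} x *\<^sub>R g x (k b + e n))
            \<longlonglongrightarrow> indicator {r<..<b} x *\<^sub>R g x (k b)"
          by (cases "x \<in> {r<..<b}") auto
      qed
      show "AE x in lborel. norm (indicator {r<..<b} x *\<^sub>R g x (k b + e n))
          \<le> indicator {r<..<b} x *\<^sub>R g x (k b)" for n
      proof (rule AE_I2)
        fix x
        have "0 < g x (k b + e n)" "g x (k b + e n) < g x (k b)" if "x \<in> {r<..<b}"
          using g_pos[of x "k b + e n"] g_strict_antimono[of x "k b" "k b + e n"] dom[OF that] e[of n]
          by auto
        then show "norm (indicator {r<..<b} x *\<^sub>R g x (k b + e n)) \<le> indicator {r<..<b} x *\<^sub>R g x (k b)"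
          by (cases "x \<in> {r<..<b}") auto
      qed
      show "(\<lambda>x. indicator {r<..<b} x *\<^sub>R g x (k b)) \<in> borel_measurable lborel"
        by (rule meas) simp
      show "(\<lambda>x. indicator {r<..<b} x *\<^sub>R g x (k b + e n)) \<in> borel_measurable lborel" for n
        by (rule meas) (use e[of n] in simp)
    qed
    moreover have "(LBINT x:{r<..<b}. g x (k b + e n)) = integral {r..b} (\<lambda>x. g x (k b + e n))" for n
    proof -
      have "continuous_on {r..b} (\<lambda>x. g x (k b + e n))"
      proof (rule g_cont')
        show "0 < x \<and> x < 2 * M \<and> k x < k b + e n" if "x \<in> {r..b}" for x
          using between_k_less[of r x b "k b + e n"] that assms b e[of n] by auto
      qed
      from interval_integral_eq_integral[OF _ borel_integrable_atLeastAtMost'[OF this]] b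
      show ?thesis by (simp add: interval_integral_Ioo)
    qed
    ultimately show ?thesis by (simp add: leaf_time_def)
  qed
  show ?thesis
    by (rule LIMSEQ_le[OF lim lim])
      (use assms e integral_endpoint_mono in auto)
qed

lemma leaf_time_split:
  assumes "0 < r'" "r' < r" "r \<le> b" "b < R"
  shows "leaf_time r' b = (LBINT x:{r'<..<r}. g x (k b)) + leaf_time r b"
proof -
  have "(LBINT x:{r'<..<b}. g x (k b)) = (LBINT x:{r'<..<r} \<union> {r<..<b}. g x (k b))"
  proof (rule set_integral_cong_set[symmetric])
    have int: "set_integrable lborel {r'<..<b} (\<lambda>x. g x (k b))"
      using g_integrable[of r' b] assms by simp
    then show "set_borel_measurable lborel {r'<..<b} (\<lambda>x. g x (k b))"
      by (auto simp: set_borel_measurable_def set_integrable_def dest: borel_measurable_integrable)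
    have "set_integrable lborel ({r'<..<r} \<union> {r<..<b}) (\<lambda>x. g x (k b))"
      by (rule set_integrable_subset[OF int]) (use assms in auto)
    then show "set_borel_measurable lborel ({r'<..<r} \<union> {r<..<b}) (\<lambda>x. g x (k b))"
      by (auto simp: set_borel_measurable_def set_integrable_def dest: borel_measurable_integrable)
    show "AE x in lborel. (x \<in> {r'<..<b}) = (x \<in> {r'<..<r} \<union> {r<..<b})"
      using AE_lborel_singleton[of r] by eventually_elim (use assms in auto)
  qed
  also have "\<dots> = (LBINT x:{r'<..<r}. g x (k b)) + (LBINT x:{r<..<b}. g x (k b))"
  proof (rule set_integral_Un)
    have int: "set_integrable lborel {r'<..<b} (\<lambda>x. g x (k b))"
      using g_integrable[of r' b] assms by simp
    show "set_integrable lborel {r'<..<r} (\<lambda>x. g x (k b))"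
      by (rule set_integrable_subset[OF int]) (use assms in auto)
    show "set_integrable lborel {r<..<b} (\<lambda>x. g x (k b))"
      by (rule set_integrable_subset[OF int]) (use assms in auto)
  qed auto
  finally show ?thesis by (simp add: leaf_time_def)
qed

text \<open>
  Weak monotonicity at \<open>r / 2\<close> becomes strict at \<open>r\<close>, because on \<open>(r / 2, r)\<close> the integrand strictly
  decreases with \<open>b\<close>.
\<close>

lemma leaf_time_strict_mono:
  assumes "0 < r" "r \<le> b1" "b1 < b2" "b2 < R"
  shows "leaf_time r b1 < leaf_time r b2"
proof -
  have half: "0 < r / 2" "r / 2 < r" "r / 2 < b1" using assms by auto
  have int: "set_integrable lborel {r / 2<..<r} (\<lambda>x. g x (k b))" if "r \<le> b" "b < R" for b
    by (rule set_integrable_subset[OF g_integrable[of "r / 2" b]]) (use assms that in auto)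
  let ?d = "\<lambda>x. g x (k b1) - g x (k b2)"
  have pos: "?d x > 0" if "x \<in> {r / 2<..<r}" for x
    using g_strict_antimono[of x "k b1" "k b2"] k_strict_mono[of x b1] k_strict_mono[of b1 b2]
      assms that R_max_less by auto
  have "(LBINT x:{r / 2<..<r}. ?d x) \<noteq> 0"
  proof
    assume z: "(LBINT x:{r / 2<..<r}. ?d x) = 0"
    have "integrable lborel (\<lambda>x. indicator {r / 2<..<r} x *\<^sub>R ?d x)"
      using set_integral_diff(1)[OF int[of b1] int[of b2]] assms by (simp add: set_integrable_def)
    moreover have "AE x in lborel. 0 \<le> indicator {r / 2<..<r} x *\<^sub>R ?d x"
      using pos by (intro AE_I2) (auto simp: indicator_def less_imp_le)
    ultimately have "AE x in lborel. indicator {r / 2<..<r} x *\<^sub>R ?d x = 0"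
      using z integral_nonneg_eq_0_iff_AE[of lborel "\<lambda>x. indicator {r / 2<..<r} x *\<^sub>R ?d x"]
      by (simp add: set_lebesgue_integral_def)
    then have "AE x in lborel. x \<notin> {r / 2<..<r}"
      by eventually_elim (use pos in \<open>force simp: indicator_def\<close>)
    then have "emeasure lborel {r / 2<..<r} = 0"
      by (subst (asm) AE_iff_measurable[where N = "{r / 2<..<r}"]) auto
    then show False using assms by simp
  qed
  moreover have "(LBINT x:{r / 2<..<r}. ?d x) \<ge> 0"
    unfolding set_lebesgue_integral_def
    by (rule Bochner_Integration.integral_nonneg) (use pos in \<open>force simp: indicator_def\<close>)
  ultimately have "(LBINT x:{r / 2<..<r}. g x (k b2)) < (LBINT x:{r / 2<..<r}. g x (k b1))"
    using set_integral_diff(2)[OF int[of b1] int[of b2]] assms by simp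
  moreover have "leaf_time (r / 2) b1 \<le> leaf_time (r / 2) b2"
    using assms half by (intro leaf_time_mono) auto
  ultimately show ?thesis
    using leaf_time_split[of "r / 2" r b1] leaf_time_split[of "r / 2" r b2] half assms by simp
qed

section \<open>Range of the leaf time\<close>

lemma leaf_time_self: "leaf_time r r = 0"
  by (simp add: leaf_time_def set_lebesgue_integral_def)

text \<open>This substitution moves the singularity to \<open>s = 0\<close> for all \<open>b\<close>, so that one function dominates.\<close>

lemma leaf_time_reflect:
  "leaf_time r b = (LBINT s. indicator {0<..<b - r} s *\<^sub>R g (b - s) (k b))"
proof -
  have "leaf_time r b = (LBINT s. indicator {r<..<b} (b + (- 1) * s) *\<^sub>R g (b + (- 1) * s) (k b))"
    unfolding leaf_time_def set_lebesgue_integral_def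
    using lborel_integral_real_affine[of "-1" "\<lambda>x. indicator {r<..<b} x *\<^sub>R g x (k b)" b] by simp
  also have "(\<lambda>s. indicator {r<..<b} (b + (- 1) * s) *\<^sub>R g (b + (- 1) * s) (k b)) =
      (\<lambda>s. indicator {0<..<b - r} s *\<^sub>R g (b - s) (k b))"
    by (auto simp: indicator_def fun_eq_iff)
  finally show ?thesis .
qed

lemma leaf_time_cont:
  assumes "0 < r" "\<beta> < R"
  shows "continuous_on {r..\<beta>} (leaf_time r)"
  unfolding continuous_on_sequentially comp_def
proof (intro allI ballI impI, elim conjE)
  fix X :: "nat \<Rightarrow> real" and b
  assume b: "b \<in> {r..\<beta>}" and Xn: "\<forall>n. X n \<in> {r..\<beta>}" and X: "X \<longlonglongrightarrow> b"
  obtain K where K: "\<And>b x. r \<le> x \<Longrightarrow> x < b \<Longrightarrow> b \<le> \<beta> \<Longrightarrow> g x (k b) \<le> K / sqrt (b - x)"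
    using g_bound[OF assms] by blast
  have gp: "0 < g x (k b)" if "r \<le> x" "x < b" "b \<le> \<beta>" for x b
    using g_pos[of x "k b"] k_strict_mono[of x b] that assms R_max_less by auto
  have meas: "(\<lambda>s. indicator {0<..<b - r} s *\<^sub>R g (b - s) (k b)) \<in> borel_measurable lborel"
    if "b \<in> {r..\<beta>}" for b
  proof -
    have "integrable lborel (\<lambda>x. indicator {r<..<b} x *\<^sub>R g x (k b))"
      using g_integrable[of r b] assms that by (simp add: set_integrable_def)
    then have "integrable lborel (\<lambda>s. indicator {r<..<b} (b + (- 1) * s) *\<^sub>R g (b + (- 1) * s) (k b))"
      by (rule lborel_integrable_real_affine) simp
    also have "(\<lambda>s. indicator {r<..<b} (b + (- 1) * s) *\<^sub>R g (b + (- 1) * s) (k b)) =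
        (\<lambda>s. indicator {0<..<b - r} s *\<^sub>R g (b - s) (k b))"
      by (auto simp: indicator_def fun_eq_iff)
    finally show ?thesis by (rule borel_measurable_integrable)
  qed
  show "(\<lambda>n. leaf_time r (X n)) \<longlonglongrightarrow> leaf_time r b"
    unfolding leaf_time_reflect
  proof (rule integral_dominated_convergence[where w = "\<lambda>s. indicator {0<..<\<beta> - r} s *\<^sub>R (K * (1 / sqrt s))"])
    show "integrable lborel (\<lambda>s. indicator {0<..<\<beta> - r} s *\<^sub>R (K * (1 / sqrt s)))"
      using set_integrable_mult_right[of K, OF inverse_sqrt_integrable[of "\<beta> - r"]] by (simp add: set_integrable_def)
    show "AE s in lborel. norm (indicator {0<..<X n - r} s *\<^sub>R g (X n - s) (k (X n)))
        \<le> indicator {0<..<\<beta> - r} s *\<^sub>R (K * (1 / sqrt s))" for n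
    proof (rule AE_I2)
      fix s :: real
      have Xb: "X n \<le> \<beta>" using Xn by auto
      show "norm (indicator {0<..<X n - r} s *\<^sub>R g (X n - s) (k (X n)))
        \<le> indicator {0<..<\<beta> - r} s *\<^sub>R (K * (1 / sqrt s))"
      proof (cases "s \<in> {0<..<X n - r}")
        case True
        then show ?thesis
          using K[of "X n - s" "X n"] gp[of "X n - s" "X n"] Xb by (auto simp: indicator_def)
      next
        case False
        \<comment> \<open>\<open>g_bound\<close> does not record the sign of \<open>K\<close>; it is
          read off by comparison with the positive value of \<open>g\<close> on the leaf ending at
          \<open>\<beta>\<close>.\<close>
        have "0 \<le> K / sqrt s" if "0 < s" "s < \<beta> - r"
          using K[of "\<beta> - s" \<beta>] gp[of "\<beta> - s" \<beta>] that by simp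
        with False show ?thesis by (auto simp: indicator_def)
      qed
    qed
    show "AE s in lborel. (\<lambda>n. indicator {0<..<X n - r} s *\<^sub>R g (X n - s) (k (X n)))
        \<longlonglongrightarrow> indicator {0<..<b - r} s *\<^sub>R g (b - s) (k b)"
      \<comment> \<open>At \<open>s = b - r\<close> the indicators may fail to converge, so this
        point is removed.\<close>
      using AE_lborel_singleton[of "b - r"]
    proof eventually_elim
      case (elim s)
      have Xr: "(\<lambda>n. X n - r) \<longlonglongrightarrow> b - r" using X by (intro tendsto_intros)
      consider "s \<le> 0" | "0 < s" "s < b - r" | "b - r < s" using elim by linarith
      then show ?case
      proof cases
        case 1
        then show ?thesis by simp
      next
        case 2
        have ev: "\<forall>\<^sub>F n in sequentially. s < X n - r" using order_tendstoD(1)[OF Xr 2(2)] .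
        let ?D = "{(c, x). 0 < x \<and> x < 2 * M \<and> k x < c}"
        have D: "(k b, b - s) \<in> ?D" if "s < b - r" "b \<in> {r..\<beta>}" for b
          using k_strict_mono[of "b - s" b] that 2 assms R_max_less by auto
        have "(\<lambda>n. (\<lambda>(c, x). g x c) (k (X n), X n - s)) \<longlonglongrightarrow> (\<lambda>(c, x). g x c) (k b, b - s)"
        proof (rule continuous_on_tendsto_compose[of ?D])
          show "continuous_on ?D (\<lambda>(c, x). g x c)" by (rule g_cont) auto
          have "(\<lambda>n. k (X n)) \<longlonglongrightarrow> k b"
            using continuous_on_tendsto_compose[OF k_cont[of UNIV] X] by simp
          then show "(\<lambda>n. (k (X n), X n - s)) \<longlonglongrightarrow> (k b, b - s)"
            using X by (intro tendsto_intros)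
          show "\<forall>\<^sub>F n in sequentially. (k (X n), X n - s) \<in> ?D"
            using ev by eventually_elim (use D Xn in blast)
        qed (use D b 2 in blast)
        then have "(\<lambda>n. g (X n - s) (k (X n))) \<longlonglongrightarrow> g (b - s) (k b)" by simp
        moreover have "\<forall>\<^sub>F n in sequentially.
            g (X n - s) (k (X n)) = indicator {0<..<X n - r} s *\<^sub>R g (X n - s) (k (X n))"
          using ev by eventually_elim (use 2 in simp)
        ultimately show ?thesis
          using 2 by (auto intro: Lim_transform_eventually)
      next
        case 3
        have "\<forall>\<^sub>F n in sequentially. X n - r < s" using order_tendstoD(2)[OF Xr 3] .
        then have "\<forall>\<^sub>F n in sequentially. 0 = indicator {0<..<X n - r} s *\<^sub>R g (X n - s) (k (X n))"
          by eventually_elim simp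
        then show ?thesis
          using 3 by (auto intro: Lim_transform_eventually[OF tendsto_const])
      qed
    qed
  qed (use meas b Xn in blast)+
qed

text \<open>\<open>W\<close> has a double zero at \<open>R\<close> for the critical value of \<open>c\<close>, which makes the limiting integral diverge logarithmically.\<close>

lemma W_R_bound: "\<exists>L>0. \<forall>x. 0 < x \<and> x < R \<longrightarrow> W x (k R) \<le> L * (R - x)\<^sup>2"
proof -
  define q where "q x = 3 * H * x\<^sup>2 * (H * x ^ 3 + k R) - 3 * M * x\<^sup>2 + 2 * x ^ 3" for x
  define q' where "q' x = 15 * H\<^sup>2 * x ^ 4 + 6 * H * k R * x - 6 * M * x + 6 * x\<^sup>2" for x
  have W': "((\<lambda>x. W x (k R)) has_real_derivative 2 * q x) (at x)" for x
    unfolding W_def q_def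
    by (auto intro!: derivative_eq_intros simp: algebra_simps power2_eq_square power3_eq_cube)
  have q_deriv: "(q has_real_derivative q' x) (at x)" for x
    unfolding q_def[abs_def] q'_def
    by (auto intro!: derivative_eq_intros simp: algebra_simps eval_nat_numeral)
  have R: "0 < R" "R < 2 * M" by (fact R_max_pos R_max_less)+
  have aR: "a R > 0" using a_pos R by simp
  have WR: "W R (k R) = 0" using W_eq[of R "k R"] R by simp
  \<comment> \<open>This is the critical equation \<open>psi R = 3 * H\<close> multiplied by
    \<open>R\<^sup>2 * a R\<close>; it makes the zero of \<open>W\<close> at \<open>R\<close> a
    double one.\<close>
  have qR: "q R = 0"
  proof -
    have "3 * H * a R = 3 * M - 2 * R"
      using psi_R_max aR by (simp add: psi_def field_simps)
    then have "R\<^sup>2 * (3 * H * a R - (3 * M - 2 * R)) = 0" by simp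
    then show ?thesis by (simp add: q_def k_def algebra_simps power2_eq_square power3_eq_cube)
  qed
  have "continuous_on {0..R} q'" unfolding q'_def[abs_def] by (intro continuous_intros)
  then have "bounded (q' ` {0..R})" by (intro compact_imp_bounded compact_continuous_image) auto
  then obtain L0 where L0: "L0 > 0" "\<And>x. x \<in> {0..R} \<Longrightarrow> \<bar>q' x\<bar> \<le> L0"
    unfolding bounded_pos by auto
  have "W x (k R) \<le> 2 * L0 * (R - x)\<^sup>2" if x: "0 < x" "x < R" for x
  proof -
    \<comment> \<open>Applying the mean value theorem to \<open>W\<close> and then to half its
      derivative \<open>q\<close> replaces a second-order Taylor expansion at
      \<open>R\<close>.\<close>
    obtain z where z: "x < z" "z < R" "W R (k R) - W x (k R) = (R - x) * (2 * q z)"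
      using MVT2[OF x(2), of "\<lambda>x. W x (k R)" "\<lambda>x. 2 * q x"] W' by blast
    obtain v where v: "z < v" "v < R" "q R - q z = (R - z) * q' v"
      using MVT2[OF z(2), of q q'] q_deriv by blast
    have "W x (k R) = 2 * ((R - x) * ((R - z) * q' v))"
      using z(3) v(3) WR qR by (simp add: algebra_simps)
    also have "\<dots> \<le> 2 * ((R - x) * ((R - x) * L0))"
    proof -
      have "q' v \<le> L0" using L0(2)[of v] v z x by auto
      then have "(R - z) * q' v \<le> (R - z) * L0" using z by (intro mult_left_mono) auto
      also have "\<dots> \<le> (R - x) * L0" using z L0 by (intro mult_right_mono) auto
      finally show ?thesis using x by (intro mult_left_mono) auto
    qed
    finally show ?thesis by (simp only: power2_eq_square mult_ac)
  qed
  then show ?thesis using L0 by (intro exI[of _ "2 * L0"]) auto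
qed

text \<open>\<open>W\<close> increases with \<open>c\<close> while \<open>k x < c\<close>, so the
  quadratic bound at \<open>k R\<close> holds on all leaves and gives
  \<open>g x (k b) \<ge> m / (R - x)\<close> with \<open>m\<close> independent of \<open>b\<close>.
  The integral of this lower bound is logarithmic in \<open>R - b\<close>.\<close>

lemma leaf_time_unbounded:
  assumes "0 < r" "r < R"
  shows "\<exists>b. r < b \<and> b < R \<and> \<tau> \<le> leaf_time r b"
proof -
  obtain L where L: "L > 0" "\<And>x. 0 < x \<Longrightarrow> x < R \<Longrightarrow> W x (k R) \<le> L * (R - x)\<^sup>2"
    using W_R_bound by blast
  have ne: "{r..R} \<noteq> {}" using assms by simp
  from continuous_attains_inf[OF compact_Icc ne a_cont] obtain x2 where x2: "x2 \<in> {r..R}"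
    "\<And>x. x \<in> {r..R} \<Longrightarrow> a x2 \<le> a x" by auto
  define m where "m = r / (2 * M) * (a x2 / sqrt L)"
  have a2: "a x2 > 0" using a_pos[of x2] x2(1) assms R_max_less by auto
  then have m: "m > 0" using L assms M_pos by (simp add: m_def)
  have ge: "m / (R - x) \<le> g x (k b)" if "r < x" "x < b" "b < R" for x b
  proof -
    have x: "0 < x" "x < 2 * M" "x < R" "x \<in> {r..R}" using that assms R_max_less by auto
    have kk: "k x < k b" "k b < k R"
      using k_strict_mono[of x b] k_strict_mono[of b R] that assms by auto
    have ax: "a x > 0" using a_pos x by simp
    have "W x (k b) \<le> W x (k R)"
      unfolding W_eq[OF less_imp_le[OF x(1)] less_imp_le[OF x(2)]]
      using kk ax by (intro mult_mono) auto
    also have "\<dots> \<le> L * (R - x)\<^sup>2" using L x by simp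
    finally have "sqrt (W x (k b)) \<le> sqrt (L * (R - x)\<^sup>2)" by simp
    then have w: "sqrt (W x (k b)) \<le> sqrt L * (R - x)" using x by (simp add: real_sqrt_mult)
    have "a x2 \<le> H * x ^ 3 + k b" using x2(2)[OF x(4)] a_less[OF kk(1)] by simp
    then have "a x2 / (sqrt L * (R - x)) \<le> (H * x ^ 3 + k b) / sqrt (W x (k b))"
      using w a2 W_pos[OF x(1,2) kk(1)] by (intro frac_le) auto
    moreover have "r / (2 * M) \<le> x / (2 * M - x)"
      using x that assms by (intro frac_le) auto
    ultimately have "r / (2 * M) * (a x2 / (sqrt L * (R - x))) \<le> g x (k b)"
      unfolding g_def using x a2 L assms M_pos by (intro mult_mono) auto
    then show ?thesis by (simp add: m_def)
  qed
  \<comment> \<open>\<open>E\<close> is the ratio \<open>(R - b) / (R - r)\<close> for which the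
    logarithmic integral equals \<open>\<bar>\<tau>\<bar> + 1\<close>.\<close>
  define E where "E = exp (- ((\<bar>\<tau>\<bar> + 1) / m))"
  define b where "b = R - (R - r) * E"
  have E: "0 < E" "E < 1" using m by (auto simp: E_def)
  have "(R - r) * E < R - r"
    using mult_strict_left_mono[OF E(2), of "R - r"] assms unfolding mult_1_right by simp
  then have b1: "r < b" unfolding b_def by linarith
  have "0 < (R - r) * E" using E assms by simp
  then have b2: "b < R" unfolding b_def by linarith
  note b = b1 b2
  have cont: "continuous_on {r..b} (\<lambda>x. m / (R - x))"
    using b by (intro continuous_intros) auto
  have "(LBINT x=r..b. m / (R - x)) = - m * ln (R - b) - (- m * ln (R - r))"
  proof (rule interval_integral_FTC_finite)
    show "((\<lambda>x. - m * ln (R - x)) has_vector_derivative m / (R - x)) (at x within {min r b..max r b})"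
      if "min r b \<le> x" "x \<le> max r b" for x
      unfolding has_real_derivative_iff_has_vector_derivative[symmetric]
      using that b by (auto intro!: derivative_eq_intros)
  qed (use cont b in simp)
  also have "ln (R - b) = ln (R - r) - (\<bar>\<tau>\<bar> + 1) / m"
    using assms E by (simp add: b_def ln_mult) (simp add: E_def)
  finally have "(LBINT x=r..b. m / (R - x)) = \<bar>\<tau>\<bar> + 1"
    using m by (simp add: right_diff_distrib)
  then have eq: "(LBINT x:{r<..<b}. m / (R - x)) = \<bar>\<tau>\<bar> + 1"
    using b by (simp add: interval_integral_Ioo)
  have "(LBINT x:{r<..<b}. m / (R - x)) \<le> leaf_time r b"
    unfolding leaf_time_def
  proof (rule set_integral_mono)
    show "set_integrable lborel {r<..<b} (\<lambda>x. m / (R - x))"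
      by (rule set_integrable_subset[OF borel_integrable_atLeastAtMost'[OF cont]]) auto
    show "set_integrable lborel {r<..<b} (\<lambda>x. g x (k b))"
      using g_integrable assms b by simp
    show "m / (R - x) \<le> g x (k b)" if "x \<in> {r<..<b}" for x
      using ge[of x b] that b by simp
  qed
  then show ?thesis using eq b by (intro exI[of _ b]) auto
qed

lemma leaf_time_surj:
  assumes "0 < r" "r < R" "0 \<le> \<tau>"
  shows "\<exists>b. r \<le> b \<and> b < R \<and> leaf_time r b = \<tau>"
proof -
  obtain b' where b': "r < b'" "b' < R" "\<tau> \<le> leaf_time r b'"
    using leaf_time_unbounded[OF assms(1,2)] by blast
  then obtain b where "r \<le> b" "b \<le> b'" "leaf_time r b = \<tau>"
    using IVT'[of "leaf_time r" r \<tau> b'] leaf_time_self leaf_time_cont[OF assms(1) b'(2)] assms by auto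
  then show ?thesis using b' by (intro exI[of _ b]) auto
qed

lemma leaf_time_nonneg:
  assumes "0 < r" "r \<le> b" "b < R"
  shows "0 \<le> leaf_time r b"
  using leaf_time_strict_mono[of r r b] leaf_time_self[of r] assms by (cases "r = b") auto

subsection \<open>Leaves in Schwarzschild coordinates\<close>

lemma height_eq:
  assumes "0 < r" "r \<le> b" "b < R"
  shows "height M H (k b) r = - leaf_time r b"
proof -
  have "height M H (k b) r = (LBINT x=ereal b..ereal r. g x (k b))"
    unfolding height_def using r_plus_k[of b] assms by (simp add: g_def W_def)
  also have "\<dots> = - (LBINT x=ereal r..ereal b. g x (k b))"
    by (rule interval_integral_endpoints_reverse)
  finally show ?thesis
    using assms by (simp add: leaf_time_def interval_integral_Ioo)
qed

definition \<phi> :: "real \<Rightarrow> real" where "\<phi> r = (r - 2 * M) * exp (r / (2 * M))"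

text \<open>The derivative is \<open>t / (2 * M) * exp (t / (2 * M))\<close>, positive for
  \<open>t > 0\<close>. This gives the uniqueness behind \<open>THE\<close> in
  \<open>area_radius\<close>.\<close>

lemma \<phi>_strict_mono:
  assumes "0 \<le> r" "r < s"
  shows "\<phi> r < \<phi> s"
proof -
  have "\<exists>d. (\<phi> has_real_derivative d) (at t) \<and> d > 0" if "r < t" "t < s" for t
  proof -
    have "(\<phi> has_real_derivative t / (2 * M) * exp (t / (2 * M))) (at t)"
      unfolding \<phi>_def[abs_def] using M_pos
      by (auto intro!: derivative_eq_intros simp: field_simps)
    then show ?thesis using that assms M_pos by (intro exI[of _ "t / (2 * M) * exp (t / (2 * M))"]) auto
  qed
  moreover have "continuous_on {r..s} \<phi>"
    unfolding \<phi>_def[abs_def] using M_pos by (intro continuous_intros) auto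
  ultimately show ?thesis
    using DERIV_pos_imp_increasing_open[OF assms(2), of \<phi>] by blast
qed

lemma area_radius_eqI:
  assumes "0 < r" "\<phi> r = U * V"
  shows "area_radius M (U, V) = r"
  unfolding area_radius_def prod.case
proof (rule the_equality)
  show "0 < r \<and> (r - 2 * M) * exp (r / (2 * M)) = U * V"
    using assms by (simp add: \<phi>_def)
  show "s = r" if "0 < s \<and> (s - 2 * M) * exp (s / (2 * M)) = U * V" for s
    using that assms \<phi>_strict_mono[of r s] \<phi>_strict_mono[of s r]
    by (cases r s rule: linorder_cases) (auto simp: \<phi>_def)
qed

text \<open>In region II' the product \<open>U * V\<close> lies strictly between
  \<open>\<phi> 0 = - 2 * M\<close> and \<open>\<phi> (2 * M) = 0\<close>, so the intermediate value
  theorem supplies the radius.\<close>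

lemma area_radius_regionII':
  assumes "(U, V) \<in> regionII' M"
  shows "0 < area_radius M (U, V)" "area_radius M (U, V) < 2 * M"
    "\<phi> (area_radius M (U, V)) = U * V"
proof -
  have UV: "- 2 * M < U * V" "U * V < 0"
    using assms by (auto simp: regionII'_def kruskal_def mult_pos_neg)
  have "continuous_on {0..2 * M} \<phi>"
    unfolding \<phi>_def[abs_def] using M_pos by (intro continuous_intros) auto
  then obtain r where r: "0 \<le> r" "r \<le> 2 * M" "\<phi> r = U * V"
    using IVT'[of \<phi> 0 "U * V" "2 * M"] UV M_pos by (auto simp: \<phi>_def)
  have "r \<noteq> 0" "r \<noteq> 2 * M" using r UV by (auto simp: \<phi>_def)
  then show "0 < area_radius M (U, V)" "area_radius M (U, V) < 2 * M"
    "\<phi> (area_radius M (U, V)) = U * V"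
    using r area_radius_eqI[of r U V] by auto
qed

text \<open>In region II' the quotient \<open>- V / U\<close> is the absolute value of
  \<open>V / U\<close>.\<close>

definition schwarzschild_time :: "real \<times> real \<Rightarrow> real" where
  "schwarzschild_time = (\<lambda>(U, V). 2 * M * ln (- V / U))"

text \<open>In logarithmic coordinates the curve separates: the sum of \<open>ln U\<close> and
  \<open>ln (- V)\<close> depends on \<open>r\<close> alone, and their difference is the height
  divided by \<open>2 * M\<close>.\<close>

lemma half_leaf_iff:
  assumes "0 < b" "b < R"
  shows "p \<in> half_leaf M H (k b) \<longleftrightarrow>
    p \<in> regionII' M \<and> area_radius M p \<le> b \<and> schwarzschild_time p = - leaf_time (area_radius M p) b"
proof (cases p)
  case (Pair U V)
  define lU where "lU r = - (1 / (4 * M)) * (height M H (k b) r - r - 2 * M * ln \<bar>r - 2 * M\<bar>)" for r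
  define lV where "lV r = 1 / (4 * M) * (height M H (k b) r + r + 2 * M * ln \<bar>r - 2 * M\<bar>)" for r
  have curve: "U_curve M H (k b) r = exp (lU r)" "V_curve M H (k b) r = - exp (lV r)" for r
    by (simp_all add: U_curve_def V_curve_def lU_def lV_def)
  have diff: "2 * M * (lV r - lU r) = height M H (k b) r" for r
    using M_pos by (simp add: lU_def lV_def field_simps)
  have sum: "lU r + lV r = r / (2 * M) + ln \<bar>r - 2 * M\<bar>" for r
    using M_pos by (simp add: lU_def lV_def field_simps)
  have \<phi>: "- exp (lU r + lV r) = \<phi> r" if "r < 2 * M" for r
    unfolding sum exp_add using that by (simp add: \<phi>_def algebra_simps)
  have rb: "r_plus M H (k b) = b" using r_plus_k assms by simp
  show ?thesis
  proof
    assume "p \<in> half_leaf M H (k b)"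
    then obtain r where r: "0 < r" "r \<le> b" "U = exp (lU r)" "V = - exp (lV r)"
      by (auto simp: half_leaf_def rb Pair curve)
    have r2: "r < 2 * M" using r assms R_max_less by simp
    have UV: "U * V = \<phi> r" using \<phi>[OF r2] by (simp add: r exp_add)
    then have area: "area_radius M p = r" using area_radius_eqI r by (simp add: Pair)
    have "- 2 * M < U * V" unfolding UV using \<phi>_strict_mono[of 0 r] r(1) by (simp add: \<phi>_def)
    then have "p \<in> regionII' M" using r(3,4) by (simp add: Pair regionII'_def kruskal_def)
    moreover have "schwarzschild_time p = height M H (k b) r"
      unfolding schwarzschild_time_def Pair prod.case diff[symmetric] by (simp add: r flip: exp_diff)
    ultimately show "p \<in> regionII' M \<and> area_radius M p \<le> b \<and> schwarzschild_time p = - leaf_time (area_radius M p) b"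
      using height_eq r assms area by simp
  next
    assume p: "p \<in> regionII' M \<and> area_radius M p \<le> b \<and> schwarzschild_time p = - leaf_time (area_radius M p) b"
    define r where "r = area_radius M p"
    have r: "0 < r" "r < 2 * M" "\<phi> r = U * V" "r \<le> b"
      using area_radius_regionII'[of U V] p by (auto simp: r_def Pair)
    have UV: "U > 0" "- V > 0" using p by (auto simp: Pair regionII'_def)
    have "2 * M * (ln (- V) - ln U) = 2 * M * (lV r - lU r)"
      unfolding diff using p height_eq[of r b] r assms UV
      by (simp add: schwarzschild_time_def Pair r_def ln_div[of "- V" U, simplified])
    then have d: "ln (- V) - ln U = lV r - lU r" using M_pos by simp
    \<comment> \<open>The time has fixed the difference of the logarithms; the area radius now fixes
      their sum, hence the point.\<close>
    have "exp (ln U + ln (- V)) = exp (lU r + lV r)"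
      using \<phi>[of r] r UV unfolding exp_add by simp
    then have "ln U + ln (- V) = lU r + lV r" by simp
    with d have "ln U = lU r" "ln (- V) = lV r" by linarith+
    then have "U = exp (lU r)" "- V = exp (lV r)" using UV exp_ln by metis+
    then have "p = (U_curve M H (k b) r, V_curve M H (k b) r)" by (simp add: Pair curve)
    then show "p \<in> half_leaf M H (k b)" using r by (auto simp: half_leaf_def rb)
  qed
qed

lemma T_reflection_simps:
  "T_reflection (T_reflection p) = p"
  "T_reflection p \<in> regionII' M \<longleftrightarrow> p \<in> regionII' M"
  "area_radius M (T_reflection p) = area_radius M p"
  by (auto simp: T_reflection_def regionII'_def kruskal_def area_radius_def mult.commute split: prod.splits)

lemma schwarzschild_time_reflection: "p \<in> regionII' M \<Longrightarrow> schwarzschild_time (T_reflection p) = - schwarzschild_time p"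
proof (cases p)
  case (Pair U V)
  assume "p \<in> regionII' M"
  then have "U > 0" "- V > 0" by (auto simp: Pair regionII'_def)
  then have "ln (U / - V) = ln U - ln (- V)" "ln (- V / U) = ln (- V) - ln U"
    unfolding ln_div by simp_all
  then have "schwarzschild_time p = 2 * M * (ln (- V) - ln U)" "schwarzschild_time (T_reflection p) = 2 * M * (ln U - ln (- V))"
    by (simp_all only: Pair T_reflection_def schwarzschild_time_def prod.case minus_minus)
  then show ?thesis by (simp add: right_diff_distrib)
qed

text \<open>The two halves carry times of opposite sign, and \<open>leaf_time\<close> is
  nonnegative, so an absolute value merges them.\<close>

lemma Sigma_plus_iff:
  assumes "0 < b" "b < R"
  shows "p \<in> Sigma_plus M H (k b) \<longleftrightarrow>
    p \<in> regionII' M \<and> area_radius M p \<le> b \<and> \<bar>schwarzschild_time p\<bar> = leaf_time (area_radius M p) b"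
proof -
  have "k b \<noteq> C_max M H" using k_strict_mono[of b R] assms by (simp add: C_max_eq)
  moreover have "p \<in> T_reflection ` half_leaf M H (k b) \<longleftrightarrow> T_reflection p \<in> half_leaf M H (k b)"
    using T_reflection_simps(1) by (metis image_iff)
  ultimately have "p \<in> Sigma_plus M H (k b) \<longleftrightarrow>
      p \<in> half_leaf M H (k b) \<or> T_reflection p \<in> half_leaf M H (k b)"
    by (simp add: Sigma_plus_def)
  also have "\<dots> \<longleftrightarrow> p \<in> regionII' M \<and> area_radius M p \<le> b \<and>
      (schwarzschild_time p = - leaf_time (area_radius M p) b \<or> schwarzschild_time p = leaf_time (area_radius M p) b)"
    using schwarzschild_time_reflection[of p] by (auto simp: half_leaf_iff[OF assms] T_reflection_simps)
  also have "\<dots> \<longleftrightarrow> p \<in> regionII' M \<and> area_radius M p \<le> b \<and> \<bar>schwarzschild_time p\<bar> = leaf_time (area_radius M p) b"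
    using leaf_time_nonneg[of "area_radius M p" b] assms area_radius_regionII'(1)[of "fst p" "snd p"]
    by (auto simp: abs_if)
  finally show ?thesis .
qed

lemma Sigma_plus_C_max: "Sigma_plus M H (C_max M H) = {p \<in> regionII' M. area_radius M p = R}"
  by (simp add: Sigma_plus_def)

section \<open>The foliation\<close>

text \<open>A common point of two leaves would give the same \<open>leaf_time\<close> at one radius
  for two endpoints, against strict monotonicity. The cylinder stays apart because every other leaf
  has radius at most some \<open>b < R\<close>.\<close>

lemma disjoint_leaves: "disjoint_family_on (Sigma_plus M H) {0<..C_max M H}"
proof -
  have "Sigma_plus M H c1 \<inter> Sigma_plus M H c2 = {}" if c: "0 < c1" "c1 < c2" "c2 \<le> C_max M H" for c1 c2
  proof (rule ccontr)
    assume "Sigma_plus M H c1 \<inter> Sigma_plus M H c2 \<noteq> {}"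
    then obtain p where p: "p \<in> Sigma_plus M H c1" "p \<in> Sigma_plus M H c2" by blast
    define r where "r = area_radius M p"
    obtain b1 where b1: "0 < b1" "b1 < R" "k b1 = c1"
      using ex_k_eq[of c1] c by auto
    have p1: "p \<in> regionII' M" "r \<le> b1" "\<bar>schwarzschild_time p\<bar> = leaf_time r b1"
      using p(1) Sigma_plus_iff[OF b1(1,2)] by (auto simp: b1 r_def)
    have "0 < r" using p1(1) area_radius_regionII'(1)[of "fst p" "snd p"] by (simp add: r_def)
    show False
    proof (cases "c2 = C_max M H")
      case True
      then show ?thesis using p(2) p1 b1 by (simp add: Sigma_plus_C_max r_def)
    next
      case False
      then obtain b2 where b2: "0 < b2" "b2 < R" "k b2 = c2" using ex_k_eq[of c2] c by auto
      have "\<bar>schwarzschild_time p\<bar> = leaf_time r b2"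
        using p(2) Sigma_plus_iff[OF b2(1,2)] by (auto simp: b2 r_def)
      moreover have "b1 < b2"
        using k_strict_mono[of b2 b1] b1 b2 \<open>c1 < c2\<close> by (cases b1 b2 rule: linorder_cases) auto
      ultimately show ?thesis
        using leaf_time_strict_mono[of r b1 b2] \<open>0 < r\<close> p1 b2 by simp
    qed
  qed
  then show ?thesis
    unfolding disjoint_family_on_def
    by (metis Int_commute greaterThanAtMost_iff linorder_neqE_linordered_idom)
qed

text \<open>For a point with radius below \<open>R\<close>, \<open>leaf_time_surj\<close> applied to
  the absolute value of its time yields the endpoint of a leaf through it; radius \<open>R\<close>
  belongs to the cylinder.\<close>

lemma Union_leaves:
  "(\<Union>c\<in>{0<..C_max M H}. Sigma_plus M H c) =
    {p \<in> regionII' M. 0 < area_radius M p \<and> area_radius M p \<le> R}"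
proof (intro equalityI subsetI)
  fix p assume "p \<in> (\<Union>c\<in>{0<..C_max M H}. Sigma_plus M H c)"
  then obtain c where c: "0 < c" "c \<le> C_max M H" "p \<in> Sigma_plus M H c" by auto
  have "p \<in> regionII' M \<and> area_radius M p \<le> R"
  proof (cases "c = C_max M H")
    case True
    then show ?thesis using c by (simp add: Sigma_plus_C_max)
  next
    case False
    then obtain b where "0 < b" "b < R" "k b = c" using ex_k_eq c by fastforce
    then show ?thesis using Sigma_plus_iff[of b p] c by auto
  qed
  then show "p \<in> {p \<in> regionII' M. 0 < area_radius M p \<and> area_radius M p \<le> R}"
    using area_radius_regionII'(1)[of "fst p" "snd p"] by simp
next
  fix p assume p: "p \<in> {p \<in> regionII' M. 0 < area_radius M p \<and> area_radius M p \<le> R}"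
  define r where "r = area_radius M p"
  have "\<exists>c. 0 < c \<and> c \<le> C_max M H \<and> p \<in> Sigma_plus M H c"
  proof (cases "r = R")
    case True
    then show ?thesis
      using p k_pos[of R] R_max_pos C_max_eq Sigma_plus_C_max
      by (intro exI[of _ "C_max M H"]) (auto simp: r_def)
  next
    case False
    then have r: "0 < r" "r < R" using p by (auto simp: r_def)
    then obtain b where b: "r \<le> b" "b < R" "leaf_time r b = \<bar>schwarzschild_time p\<bar>"
      using leaf_time_surj[of r "\<bar>schwarzschild_time p\<bar>"] by auto
    have "0 < k b" "k b \<le> C_max M H"
      using k_pos[of b] k_strict_mono[of b R] r b by (auto simp: C_max_eq)
    moreover have "p \<in> Sigma_plus M H (k b)"
      using Sigma_plus_iff[of b p] r b p by (simp add: r_def)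
    ultimately show ?thesis by blast
  qed
  then show "p \<in> (\<Union>c\<in>{0<..C_max M H}. Sigma_plus M H c)" by auto
qed

end

theorem theorem3p12:
  fixes M H :: real
  assumes "M > 0"
  shows "disjoint_family_on (Sigma_plus M H) {0<..C_max M H} \<and>
         (\<Union>c\<in>{0<..C_max M H}. Sigma_plus M H c) =
           {p \<in> regionII' M. 0 < area_radius M p \<and> area_radius M p \<le> R_max M H}"
proof -
  interpret kruskal_cmc M H by unfold_locales (fact assms)
  show ?thesis using disjoint_leaves Union_leaves by blast
qed

end
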